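(* Let $\mathcal U$ be a universal Martin-Löf test. Then $\mathsf{LAY}_{\mathcal U}\ast\mathsf{LAY}_{\mathcal U}\le_{\mathrm W}\mathsf{LAY}_{\mathcal U}$; that is, whenever $f_0\colon\subseteq R\rightrightarrows S$ and $g_0\colon\subseteq Q\rightrightarrows R$ are multi-valued partial functions on represented spaces with $f_0\le_{\mathrm W}\mathsf{LAY}_{\mathcal U}$, $g_0\le_{\mathrm W}\mathsf{LAY}_{\mathcal U}$, and $g_0(x)\subseteq\mathrm{dom}(f_0)$ for all $x\in\mathrm{dom}(g_0)$, we have $f_0\circ g_0\le_{\mathrm W}\mathsf{LAY}_{\mathcal U}$.
   Context: Cantor space $2^\omega$, Lebesgue measure $\lambda$. A Martin-Löf (ML) test is a sequence $(\mathcal V_i)_{i\in\omega}$ of open subsets of $2^\omega$ such that $\{\langle i,\sigma\rangle:[\sigma]\subseteq\mathcal V_i\}$ is c.e. and $\lambda(\mathcal V_i)\le 2^{-i}$; it is universal if $\bigcap_i\mathcal V'_i\subseteq\bigcap_i\mathcal V_i$ for every ML-test $\mathcal V'$. $\mathrm{MLR}$ is the set of Martin-Löf random sequences. A representation of a set $X$ is a surjective partial map $\delta_X:\subseteq\omega^\omega\to X$. A realizer of a multi-valued partial function $f:\subseteq X\rightrightarrows Y$ is a partial $\Gamma:\subseteq\omega^\omega\to\omega^\omega$ with $\delta_Y(\Gamma(p))\in f(\delta_X(p))$ for all $p\in\mathrm{dom}(f\circ\delta_X)$. $f\le_{\mathrm W} g$ if there are Turing functionals $\Phi,\Psi$ such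 that $p\mapsto\Psi(\langle p,\Gamma(\Phi(p))\rangle)$ realizes $f$ for every realizer $\Gamma$ of $g$. $\mathrm{MLR}$ is represented by the identity on $\mathrm{MLR}\subseteq\omega^\omega$, $\omega$ by $\chi_{\{n\}}\mapsto n$. $\mathsf{LAY}_{\mathcal U}\colon\mathrm{MLR}\rightrightarrows\omega$, $\mathsf{LAY}_{\mathcal U}(X)=\{i:X\notin\mathcal U_i\}$. Composition of multi-valued functions: $(f_0\circ g_0)(x)=\bigcup_{y\in g_0(x)}f_0(y)$. The compositional product $f\ast g$ is the $\le_{\mathrm W}$-maximum (which exists) of $\{f_0\circ g_0 : f_0\le_{\mathrm W} f,\ g_0\le_{\mathrm W} g,\ f_0,g_0 \text{ composable}\}$. *)

theory Defs
  imports "HOL-Probability.Probability" "HOL-Library.Nat_Bijection"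
begin

datatype rf = Zr | Sc | Pj nat | Cm rf "rf list" | Pr rf rf | Mn rf | Orc

inductive ev :: "(nat \<Rightarrow> nat) \<Rightarrow> rf \<Rightarrow> nat list \<Rightarrow> nat \<Rightarrow> bool" for f where
  ev_Zr: "ev f Zr xs 0"
| ev_Sc: "ev f Sc (x # xs) (Suc x)"
| ev_Pj: "i < length xs \<Longrightarrow> ev f (Pj i) xs (xs ! i)"
| ev_Orc: "ev f Orc (x # xs) (f x)"
| ev_Cm: "list_all2 (\<lambda>g y. ev f g xs y) gs ys \<Longrightarrow> ev f h ys z \<Longrightarrow> ev f (Cm h gs) xs z"
| ev_Pr0: "ev f g xs y \<Longrightarrow> ev f (Pr g h) (0 # xs) y"
| ev_PrS: "ev f (Pr g h) (n # xs) y \<Longrightarrow> ev f h (n # y # xs) z \<Longrightarrow> ev f (Pr g h) (Suc n # xs) z"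
| ev_Mn: "ev f g (n # xs) 0 \<Longrightarrow> (\<forall>m<n. \<exists>y. y \<noteq> 0 \<and> ev f g (m # xs) y) \<Longrightarrow> ev f (Mn g) xs n"

definition tf :: "rf \<Rightarrow> (nat \<Rightarrow> nat) \<Rightarrow> (nat \<Rightarrow> nat) option" where
  "tf e p = (if \<forall>n. \<exists>y. ev p e [n] y then Some (\<lambda>n. THE y. ev p e [n] y) else None)"

definition ce :: "nat set \<Rightarrow> bool" where
  "ce A \<longleftrightarrow> (\<exists>e. \<forall>n. n \<in> A \<longleftrightarrow> (\<exists>y. ev (\<lambda>_. 0) e [n] y))"

definition cyl :: "bool list \<Rightarrow> (nat \<Rightarrow> bool) set" where
  "cyl \<sigma> = {X. \<forall>k < length \<sigma>. X k = \<sigma> ! k}"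

definition code_str :: "nat \<Rightarrow> bool list \<Rightarrow> nat" where
  "code_str i \<sigma> = prod_encode (i, list_encode (map of_bool \<sigma>))"

definition lebC :: "(nat \<Rightarrow> bool) measure" where
  "lebC = PiM UNIV (\<lambda>_. measure_pmf (bernoulli_pmf (1/2)))"

definition c_open :: "(nat \<Rightarrow> bool) set \<Rightarrow> bool" where
  "c_open V \<longleftrightarrow> (\<forall>X\<in>V. \<exists>\<sigma>. X \<in> cyl \<sigma> \<and> cyl \<sigma> \<subseteq> V)"

definition ml_test :: "(nat \<Rightarrow> (nat \<Rightarrow> bool) set) \<Rightarrow> bool" where
  "ml_test V \<longleftrightarrow> (\<forall>i. c_open (V i))
     \<and> ce {code_str i \<sigma> | i \<sigma>. cyl \<sigma> \<subseteq> V i}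
     \<and> (\<forall>i. emeasure lebC (V i) \<le> ennreal ((1/2) ^ i))"

definition universal_ml_test :: "(nat \<Rightarrow> (nat \<Rightarrow> bool) set) \<Rightarrow> bool" where
  "universal_ml_test U \<longleftrightarrow> ml_test U \<and> (\<forall>V. ml_test V \<longrightarrow> (\<Inter>i. V i) \<subseteq> (\<Inter>i. U i))"

definition MLR :: "(nat \<Rightarrow> bool) set" where
  "MLR = {X. \<forall>V. ml_test V \<longrightarrow> X \<notin> (\<Inter>i. V i)}"

definition carrier_rep :: "((nat \<Rightarrow> nat) \<Rightarrow> 'a option) \<Rightarrow> 'a set" where
  "carrier_rep \<delta> = {x. \<exists>p. \<delta> p = Some x}"

text \<open>Multi-valued partial function f :\<subseteq> X \<rightrightarrows> Y, dom f = {x. f x \<noteq> {}}.\<close>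
definition mvf :: "((nat \<Rightarrow> nat) \<Rightarrow> 'a option) \<Rightarrow> ((nat \<Rightarrow> nat) \<Rightarrow> 'b option) \<Rightarrow> ('a \<Rightarrow> 'b set) \<Rightarrow> bool" where
  "mvf \<delta>X \<delta>Y f \<longleftrightarrow> (\<forall>x. f x \<noteq> {} \<longrightarrow> x \<in> carrier_rep \<delta>X \<and> f x \<subseteq> carrier_rep \<delta>Y)"

definition mv_comp :: "('b \<Rightarrow> 'c set) \<Rightarrow> ('a \<Rightarrow> 'b set) \<Rightarrow> 'a \<Rightarrow> 'c set" where
  "mv_comp f g x = (\<Union>y\<in>g x. f y)"

definition realizes :: "((nat \<Rightarrow> nat) \<Rightarrow> 'a option) \<Rightarrow> ((nat \<Rightarrow> nat) \<Rightarrow> 'b option) \<Rightarrow> ('a \<Rightarrow> 'b set)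
    \<Rightarrow> ((nat \<Rightarrow> nat) \<Rightarrow> (nat \<Rightarrow> nat) option) \<Rightarrow> bool" where
  "realizes \<delta>X \<delta>Y f \<Gamma> \<longleftrightarrow>
     (\<forall>p x. \<delta>X p = Some x \<longrightarrow> f x \<noteq> {} \<longrightarrow> (\<exists>q y. \<Gamma> p = Some q \<and> \<delta>Y q = Some y \<and> y \<in> f x))"

definition bpair :: "(nat \<Rightarrow> nat) \<Rightarrow> (nat \<Rightarrow> nat) \<Rightarrow> nat \<Rightarrow> nat" where
  "bpair p q n = (if even n then p (n div 2) else q (n div 2))"

definition W_le :: "((nat \<Rightarrow> nat) \<Rightarrow> 'a option) \<Rightarrow> ((nat \<Rightarrow> nat) \<Rightarrow> 'b option) \<Rightarrow> ('a \<Rightarrow> 'b set)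
    \<Rightarrow> ((nat \<Rightarrow> nat) \<Rightarrow> 'c option) \<Rightarrow> ((nat \<Rightarrow> nat) \<Rightarrow> 'd option) \<Rightarrow> ('c \<Rightarrow> 'd set) \<Rightarrow> bool" where
  "W_le \<delta>X \<delta>Y f \<delta>Z \<delta>W g \<longleftrightarrow>
     (\<exists>\<Phi> \<Psi>. \<forall>\<Gamma>. realizes \<delta>Z \<delta>W g \<Gamma> \<longrightarrow>
        realizes \<delta>X \<delta>Y f (\<lambda>p. Option.bind (tf \<Phi> p) (\<lambda>r. Option.bind (\<Gamma> r) (\<lambda>q. tf \<Psi> (bpair p q)))))"

definition delta_MLR :: "(nat \<Rightarrow> nat) \<Rightarrow> (nat \<Rightarrow> bool) option" where
  "delta_MLR p = (if (\<forall>n. p n \<le> 1) \<and> (\<lambda>n. p n = 1) \<in> MLR then Some (\<lambda>n. p n = 1) else None)"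

definition delta_nat :: "(nat \<Rightarrow> nat) \<Rightarrow> nat option" where
  "delta_nat p = (if \<exists>n. p = (\<lambda>k. if k = n then 1 else 0)
                  then Some (THE n. p = (\<lambda>k. if k = n then 1 else 0)) else None)"

definition LAY :: "(nat \<Rightarrow> (nat \<Rightarrow> bool) set) \<Rightarrow> (nat \<Rightarrow> bool) \<Rightarrow> nat set" where
  "LAY U X = (if X \<in> MLR then {i. X \<notin> U i} else {})"

end

theory Submission
  imports Defs
begin

text \<open>Given a name \<open>p\<close>, the first reduction computes an instance \<open>X\<close>, and a correct level \<open>i\<close> for \<open>X\<close>
  yields a random \<open>Y\<^sub>i\<close> together with the need for a correct level \<open>j\<close> for \<open>Y\<^sub>i\<close>. We compute a single random
  \<open>Z\<close> by copying bits of \<open>Y\<^sub>i\<close> for the current guess \<open>(i, j)\<close>; a wrong guess is eventually refuted because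
  the test is c.e. When a guess is refuted at stage \<open>t\<close>, zeros are appended until the output is
  seen to lie in all levels up to \<open>t\<close>, which happens because the universal test contains all
  eventually zero sequences. The guess changes only finitely often, so \<open>Z\<close> is a finite modification
  of some \<open>Y\<^sub>i\<close> and hence random; and if \<open>Z\<close> is not in level \<open>z\<close>, then all changes occurred
  before stage \<open>z\<close>, so running the construction for \<open>z\<close> stages recovers a correct guess.\<close>

section \<open>Computable functionals\<close>

text \<open>The second instance depends on the answer to the first, yet a single query is allowed.
  For a wrong \<open>i\<close>, neither the inner \<open>\<Psi>\<close> nor the outer
  \<open>\<Phi>'\<close> need converge, and bits that do appear need not belong to a random
  sequence. So the construction never waits for a bit: it uses stagewise approximations in which
  "unknown" is a legal answer, and \<open>computable\<close> can demand totality on every oracle. A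
  correct guess is never confirmed, and the only information that comes back is a level avoided by
  \<open>Z\<close>; the level therefore has to serve as a clock. Appending zeros can always push the
  output further: the cylinders of initial zeros form a test, so the zero sequence is not random; a
  bit flip preserves measure and carries tests to tests, so no finite variant of it is random;
  universality then puts each variant into every level.\<close>

definition computable :: "nat \<Rightarrow> ((nat \<Rightarrow> nat) \<Rightarrow> nat list \<Rightarrow> nat) \<Rightarrow> bool" where
  "computable n F \<longleftrightarrow> (\<exists>e. \<forall>p xs. length xs = n \<longrightarrow> ev p e xs (F p xs))"

lemma computable_cong:
  assumes "computable n F" "\<And>p xs. length xs = n \<Longrightarrow> F p xs = G p xs"
  shows "computable n G"
  using assms unfolding computable_def by metis

lemma computable_zero: "computable n (\<lambda>p xs. 0)"
  unfolding computable_def using ev_Zr by blast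

lemma computable_nth: "i < n \<Longrightarrow> computable n (\<lambda>p xs. xs ! i)"
  unfolding computable_def by (metis ev_Pj)

lemma computable_compose_list:
  assumes H: "computable (length Gs) H" and Gs: "\<And>G. G \<in> set Gs \<Longrightarrow> computable n G"
  shows "computable n (\<lambda>p xs. H p (map (\<lambda>G. G p xs) Gs))"
proof -
  from H obtain h where h: "\<And>p ys. length ys = length Gs \<Longrightarrow> ev p h ys (H p ys)"
    unfolding computable_def by blast
  have "\<forall>G\<in>set Gs. \<exists>e. \<forall>p xs. length xs = n \<longrightarrow> ev p e xs (G p xs)"
    using Gs unfolding computable_def by blast
  then obtain E where E: "\<And>G p xs. G \<in> set Gs \<Longrightarrow> length xs = n \<Longrightarrow> ev p (E G) xs (G p xs)"
    by metis
  have "ev p (Cm h (map E Gs)) xs (H p (map (\<lambda>G. G p xs) Gs))" if "length xs = n" for p xs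
  proof (rule ev_Cm)
    show "list_all2 (\<lambda>g y. ev p g xs y) (map E Gs) (map (\<lambda>G. G p xs) Gs)"
      using E that by (auto simp: list_all2_conv_all_nth)
  qed (simp add: h)
  then show ?thesis unfolding computable_def by blast
qed

lemma computable_compose1:
  assumes "computable 1 (\<lambda>p xs. F p (xs ! 0))" "computable n A"
  shows "computable n (\<lambda>p xs. F p (A p xs))"
proof -
  have "computable n (\<lambda>p xs. (\<lambda>p xs. F p (xs ! 0)) p (map (\<lambda>G. G p xs) [A]))"
    by (rule computable_compose_list) (use assms in auto)
  then show ?thesis by simp
qed

lemma computable_compose2:
  assumes "computable 2 (\<lambda>p xs. F p (xs ! 0) (xs ! 1))" "computable n A" "computable n B"
  shows "computable n (\<lambda>p xs. F p (A p xs) (B p xs))"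
proof -
  have "computable n (\<lambda>p xs. (\<lambda>p xs. F p (xs ! 0) (xs ! 1)) p (map (\<lambda>G. G p xs) [A, B]))"
    by (rule computable_compose_list) (use assms in \<open>auto simp: numeral_2_eq_2\<close>)
  then show ?thesis by simp
qed

lemma computable_compose3:
  assumes "computable 3 (\<lambda>p xs. F p (xs ! 0) (xs ! 1) (xs ! 2))"
    "computable n A" "computable n B" "computable n C"
  shows "computable n (\<lambda>p xs. F p (A p xs) (B p xs) (C p xs))"
proof -
  have "computable n (\<lambda>p xs. (\<lambda>p xs. F p (xs ! 0) (xs ! 1) (xs ! 2)) p (map (\<lambda>G. G p xs) [A, B, C]))"
    by (rule computable_compose_list) (use assms in \<open>auto simp: numeral_3_eq_3\<close>)
  then show ?thesis by simp
qed

text \<open>Weakening in de Bruijn style: a recursion or bounded sum puts its local variables in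
  front of the argument list, so parameters are reached through \<open>drop k\<close>.\<close>

lemma computable_drop:
  assumes "computable n F" "m = k + n"
  shows "computable m (\<lambda>p xs. F p (drop k xs))"
proof -
  have "computable m (\<lambda>p xs. F p (map (\<lambda>G. G p xs) (map (\<lambda>i p xs. xs ! (k + i)) [0..<n])))"
    by (rule computable_compose_list) (use assms computable_nth in auto)
  then show ?thesis
  proof (rule computable_cong)
    fix p :: "nat \<Rightarrow> nat" and xs :: "nat list" assume "length xs = m"
    then have "map (\<lambda>G. G p xs) (map (\<lambda>i p xs. xs ! (k + i)) [0..<n]) = drop k xs"
      using assms(2) by (intro nth_equalityI) auto
    then show "F p (map (\<lambda>G. G p xs) (map (\<lambda>i p xs. xs ! (k + i)) [0..<n])) = F p (drop k xs)"
      by simp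
  qed
qed

text \<open>Substitution for the first argument underneath \<open>k\<close> such local
  variables.\<close>

lemma computable_compose_drop:
  assumes "computable (Suc q) (\<lambda>p ys. G p (ys ! 0) (drop 1 ys))" "computable (k + q) A"
  shows "computable (k + q) (\<lambda>p xs. G p (A p xs) (drop k xs))"
proof -
  let ?Gs = "A # map (\<lambda>i p xs. xs ! (k + i)) [0..<q]"
  have G: "computable (length ?Gs) (\<lambda>p ys. G p (ys ! 0) (drop 1 ys))"
    using assms(1) by simp
  have "computable (k + q) (\<lambda>p xs. (\<lambda>p ys. G p (ys ! 0) (drop 1 ys)) p (map (\<lambda>G. G p xs) ?Gs))"
    by (rule computable_compose_list[OF G]) (use assms(2) computable_nth in auto)
  then show ?thesis
  proof (rule computable_cong)
    fix p :: "nat \<Rightarrow> nat" and xs :: "nat list" assume "length xs = k + q"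
    then have "map (\<lambda>G. G p xs) (map (\<lambda>i p xs. xs ! (k + i)) [0..<q]) = drop k xs"
      by (intro nth_equalityI) auto
    then show "(\<lambda>p ys. G p (ys ! 0) (drop 1 ys)) p (map (\<lambda>G. G p xs) ?Gs) = G p (A p xs) (drop k xs)"
      by simp
  qed
qed

lemma computable_drop_nth: "k + i < n \<Longrightarrow> computable n (\<lambda>p xs. drop k xs ! i)"
  by (rule computable_cong[OF computable_nth[of "k + i"]]) auto

lemma computable_Suc: "computable n A \<Longrightarrow> computable n (\<lambda>p xs. Suc (A p xs))"
proof (rule computable_compose1[where F = "\<lambda>p. Suc"])
  show "computable 1 (\<lambda>p xs. Suc (xs ! 0))"
    unfolding computable_def
    by (rule exI[of _ Sc]) (auto simp: length_Suc_conv intro: ev_Sc)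
qed

lemma computable_oracle: "computable n A \<Longrightarrow> computable n (\<lambda>p xs. p (A p xs))"
proof (rule computable_compose1[where F = "\<lambda>p. p"])
  show "computable 1 (\<lambda>p xs. p (xs ! 0))"
    unfolding computable_def
    by (rule exI[of _ Orc]) (auto simp: length_Suc_conv intro: ev_Orc)
qed

lemma computable_const: "computable n (\<lambda>p xs. c)"
  by (induction c) (auto intro: computable_zero computable_Suc)

lemma computable_rec_nat:
  assumes A: "computable n A"
    and H: "computable (Suc (Suc n)) (\<lambda>p ys. H p (ys ! 0) (ys ! 1) (drop 2 ys))"
    and N: "computable n N"
  shows "computable n (\<lambda>p xs. rec_nat (A p xs) (\<lambda>m y. H p m y xs) (N p xs))"
proof -
  from A obtain a where a: "\<And>p xs. length xs = n \<Longrightarrow> ev p a xs (A p xs)"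
    unfolding computable_def by blast
  from H obtain h where h: "\<And>p ys. length ys = Suc (Suc n) \<Longrightarrow>
      ev p h ys (H p (ys ! 0) (ys ! 1) (drop 2 ys))"
    unfolding computable_def by blast
  have R: "ev p (Pr a h) (k # xs) (rec_nat (A p xs) (\<lambda>m y. H p m y xs) k)" if "length xs = n" for p xs k
  proof (induction k)
    case 0
    show ?case using a[OF that] by (auto intro: ev_Pr0)
  next
    case (Suc k)
    show ?case
      by (rule ev_PrS[OF Suc]) (use h[of "k # _ # xs"] that in auto)
  qed
  have "computable (Suc n) (\<lambda>p ys. rec_nat (A p (tl ys)) (\<lambda>m y. H p m y (tl ys)) (hd ys))"
    unfolding computable_def
    by (rule exI[of _ "Pr a h"]) (auto simp: length_Suc_conv intro: R)
  then have "computable n (\<lambda>p xs. (\<lambda>p ys. rec_nat (A p (tl ys)) (\<lambda>m y. H p m y (tl ys)) (hd ys)) p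
      (map (\<lambda>G. G p xs) (N # map (\<lambda>i p xs. xs ! i) [0..<n])))"
    by (intro computable_compose_list) (use N computable_nth in auto)
  then show ?thesis
  proof (rule computable_cong)
    fix p :: "nat \<Rightarrow> nat" and xs :: "nat list" assume "length xs = n"
    then have "map (\<lambda>G. G p xs) (map (\<lambda>i p xs. xs ! i) [0..<n]) = xs"
      by (intro nth_equalityI) auto
    then show "(\<lambda>p ys. rec_nat (A p (tl ys)) (\<lambda>m y. H p m y (tl ys)) (hd ys)) p
      (map (\<lambda>G. G p xs) (N # map (\<lambda>i p xs. xs ! i) [0..<n]))
        = rec_nat (A p xs) (\<lambda>m y. H p m y xs) (N p xs)"
      by simp
  qed
qed

lemma computable_if_zero:
  assumes "computable n A" "computable n B" "computable n C"
  shows "computable n (\<lambda>p xs. if A p xs = 0 then B p xs else C p xs)"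
proof -
  have "computable n (\<lambda>p xs. rec_nat (B p xs) (\<lambda>m y. C p xs) (A p xs))"
    by (rule computable_rec_nat) (use assms computable_drop[of n C _ 2] in auto)
  then show ?thesis
  proof (rule computable_cong)
    show "rec_nat (B p xs) (\<lambda>m y. C p xs) (A p xs) = (if A p xs = 0 then B p xs else C p xs)" for p xs
      by (cases "A p xs") auto
  qed
qed

lemma computable_add:
  assumes "computable n A" "computable n B"
  shows "computable n (\<lambda>p xs. A p xs + B p xs)"
proof -
  have *: "rec_nat a (\<lambda>m. Suc) b = a + b" for a b by (induction b) auto
  have "computable n (\<lambda>p xs. rec_nat (A p xs) (\<lambda>m y. Suc y) (B p xs))"
    by (intro computable_rec_nat computable_Suc computable_nth assms) auto
  then show ?thesis by (simp add: *)
qed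

lemma computable_mult:
  assumes "computable n A" "computable n B"
  shows "computable n (\<lambda>p xs. A p xs * B p xs)"
proof -
  have *: "rec_nat 0 (\<lambda>m y. y + a) b = a * b" for a b :: nat by (induction b) auto
  have "computable n (\<lambda>p xs. rec_nat 0 (\<lambda>m y. y + A p xs) (B p xs))"
    by (intro computable_rec_nat computable_zero computable_add computable_nth assms
        computable_drop[OF assms(1)]) auto
  then show ?thesis by (simp add: *)
qed

lemma computable_diff:
  assumes "computable n A" "computable n B"
  shows "computable n (\<lambda>p xs. A p xs - B p xs)"
proof -
  have pred: "computable 1 (\<lambda>p xs. xs ! 0 - 1)"
  proof -
    have *: "rec_nat 0 (\<lambda>m y. m) b = b - 1" for b by (cases b) auto
    have "computable 1 (\<lambda>p xs. rec_nat 0 (\<lambda>m y. m) (xs ! 0))"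
      by (intro computable_rec_nat computable_zero computable_nth) auto
    then show ?thesis by (simp only: *)
  qed
  have *: "rec_nat a (\<lambda>m y. y - 1) b = a - b" for a b :: nat by (induction b) auto
  have "computable n (\<lambda>p xs. rec_nat (A p xs) (\<lambda>m y. y - 1) (B p xs))"
    by (intro computable_rec_nat assms computable_compose1[OF pred] computable_nth) auto
  then show ?thesis by (simp only: *)
qed

lemma computable_sum:
  assumes F: "computable (Suc n) (\<lambda>p ys. F p (ys ! 0) (drop 1 ys))" and N: "computable n N"
  shows "computable n (\<lambda>p xs. \<Sum>i<N p xs. F p i xs)"
proof -
  have *: "rec_nat 0 (\<lambda>m y. y + f m) b = (\<Sum>i<b. f i)" for f :: "nat \<Rightarrow> nat" and b
    by (induction b) auto
  have "computable (2 + n) (\<lambda>p ys. F p (ys ! 0) (drop 2 ys))"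
    by (intro computable_compose_drop[OF F] computable_nth) simp
  then have "computable n (\<lambda>p xs. rec_nat 0 (\<lambda>m y. y + F p m xs) (N p xs))"
    by (intro computable_rec_nat computable_zero computable_add computable_nth N) auto
  then show ?thesis by (simp add: *)
qed

section \<open>Decidable predicates\<close>

definition decidable :: "nat \<Rightarrow> ((nat \<Rightarrow> nat) \<Rightarrow> nat list \<Rightarrow> bool) \<Rightarrow> bool" where
  "decidable n P \<longleftrightarrow> computable n (\<lambda>p xs. of_bool (P p xs))"

lemma decidable_eq_zero: "computable n A \<Longrightarrow> decidable n (\<lambda>p xs. A p xs = 0)"
  unfolding decidable_def of_bool_def
  by (intro computable_if_zero computable_const)

lemma decidable_not: "decidable n P \<Longrightarrow> decidable n (\<lambda>p xs. \<not> P p xs)"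
  unfolding decidable_def
  by (rule computable_cong[OF computable_diff[OF computable_const[of _ 1]]]) auto

lemma decidable_conj:
  "decidable n P \<Longrightarrow> decidable n Q \<Longrightarrow> decidable n (\<lambda>p xs. P p xs \<and> Q p xs)"
  unfolding decidable_def
  by (drule (1) computable_mult) (simp add: of_bool_conj)

lemma decidable_disj:
  "decidable n P \<Longrightarrow> decidable n Q \<Longrightarrow> decidable n (\<lambda>p xs. P p xs \<or> Q p xs)"
  using decidable_not[OF decidable_conj[OF decidable_not[of n P] decidable_not[of n Q]]] by simp

lemma decidable_le:
  assumes "computable n A" "computable n B"
  shows "decidable n (\<lambda>p xs. A p xs \<le> B p xs)"
  using decidable_eq_zero[OF computable_diff[OF assms]] by simp

lemma decidable_less:
  assumes "computable n A" "computable n B"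
  shows "decidable n (\<lambda>p xs. A p xs < B p xs)"
  using decidable_not[OF decidable_le[OF assms(2,1)]] by (simp add: not_le)

lemma decidable_eq:
  assumes "computable n A" "computable n B"
  shows "decidable n (\<lambda>p xs. A p xs = B p xs)"
  using decidable_conj[OF decidable_le[OF assms] decidable_le[OF assms(2,1)]]
  by (simp add: eq_iff)

lemma computable_if:
  assumes "decidable n P" "computable n A" "computable n B"
  shows "computable n (\<lambda>p xs. if P p xs then A p xs else B p xs)"
  by (rule computable_cong[OF computable_if_zero[OF assms(1)[unfolded decidable_def] assms(3,2)]]) auto

lemma computable_of_bool: "decidable n P \<Longrightarrow> computable n (\<lambda>p xs. of_bool (P p xs))"
  by (simp add: decidable_def)

lemma decidable_all_less:
  assumes "decidable (Suc n) (\<lambda>p ys. P p (ys ! 0) (drop 1 ys))" and "computable n N"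
  shows "decidable n (\<lambda>p xs. \<forall>i<N p xs. P p i xs)"
proof -
  have "decidable n (\<lambda>p xs. (\<Sum>i<N p xs. of_bool (\<not> P p i xs)) = (0 :: nat))"
    by (intro decidable_eq_zero computable_sum computable_of_bool decidable_not assms)
  then show ?thesis
    unfolding decidable_def by (rule computable_cong) (auto simp: sum_eq_0_iff)
qed

section \<open>Computability of pairing\<close>

lemma computable_prod_encode:
  assumes "computable n A" "computable n B"
  shows "computable n (\<lambda>p xs. prod_encode (A p xs, B p xs))"
proof -
  have "triangle k = (\<Sum>i<k. Suc i)" for k
    by (induction k) auto
  then show ?thesis unfolding prod_encode_def
    by (simp del: sum.lessThan_Suc sum_Suc)
       (intro computable_add computable_sum computable_Suc computable_nth assms; simp)
qed

text \<open>Turns decoding into a bounded search: both components are at most the code, and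
  injectivity of \<open>prod_encode\<close> lets only one summand survive.\<close>

lemma sum_prod_decode:
  "(\<Sum>a<Suc m. \<Sum>b<Suc m. if prod_encode (a, b) = m then f a b else 0)
     = f (fst (prod_decode m)) (snd (prod_decode m))" for f :: "nat \<Rightarrow> nat \<Rightarrow> nat"
proof -
  obtain a0 b0 where ab: "prod_decode m = (a0, b0)" by (cases "prod_decode m")
  then have m: "m = prod_encode (a0, b0)" by (metis prod_decode_inverse)
  have le: "a0 < Suc m" "b0 < Suc m"
    using m le_prod_encode_1 le_prod_encode_2 by (auto simp: less_Suc_eq_le)
  have "(\<Sum>a<Suc m. \<Sum>b<Suc m. if prod_encode (a, b) = m then f a b else 0)
      = (\<Sum>a<Suc m. \<Sum>b<Suc m. if b = b0 then if a = a0 then f a b else 0 else 0)"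
    by (intro sum.cong refl) (auto simp: m prod_encode_eq)
  also have "\<dots> = f a0 b0"
    using le by (simp del: sum.lessThan_Suc)
  finally show ?thesis by (simp add: ab)
qed

lemma computable_fst_prod_decode:
  assumes "computable n A"
  shows "computable n (\<lambda>p xs. fst (prod_decode (A p xs)))"
proof (rule computable_compose1[OF _ assms])
  show "computable 1 (\<lambda>p xs. fst (prod_decode (xs ! 0)))"
    unfolding sum_prod_decode[of _ "\<lambda>a b. a", symmetric]
    by (intro computable_sum computable_if decidable_eq computable_prod_encode
        computable_nth computable_Suc computable_zero computable_drop_nth)
       (simp_all add: computable_drop_nth)
qed

lemma computable_snd_prod_decode:
  assumes "computable n A"
  shows "computable n (\<lambda>p xs. snd (prod_decode (A p xs)))"
proof (rule computable_compose1[OF _ assms])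
  show "computable 1 (\<lambda>p xs. snd (prod_decode (xs ! 0)))"
    unfolding sum_prod_decode[of _ "\<lambda>a b. b", symmetric]
    by (intro computable_sum computable_if decidable_eq computable_prod_encode
        computable_nth computable_Suc computable_zero computable_drop_nth)
       (simp_all add: computable_drop_nth)
qed

lemmas computable_intros =
  computable_zero computable_const computable_nth computable_drop_nth computable_Suc computable_oracle
  computable_add computable_mult computable_diff computable_if computable_of_bool
  computable_prod_encode computable_fst_prod_decode computable_snd_prod_decode
  decidable_eq decidable_less decidable_le decidable_not decidable_conj decidable_disj

text \<open>The projection \<open>Pj 0\<close> cuts the argument list of a query to its head:
  \<open>Orc\<close> reads only the head, whereas \<open>g\<close> is meant for lists of length
  one.\<close>

primrec oracle_subst :: "rf \<Rightarrow> rf \<Rightarrow> rf" where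
  "oracle_subst g Zr = Zr"
| "oracle_subst g Sc = Sc"
| "oracle_subst g (Pj i) = Pj i"
| "oracle_subst g (Cm h gs) = Cm (oracle_subst g h) (map (oracle_subst g) gs)"
| "oracle_subst g (Pr a h) = Pr (oracle_subst g a) (oracle_subst g h)"
| "oracle_subst g (Mn a) = Mn (oracle_subst g a)"
| "oracle_subst g Orc = Cm g [Pj 0]"

lemma ev_oracle_subst:
  assumes "ev f e xs y" and g: "\<And>x. ev p g [x] (f x)"
  shows "ev p (oracle_subst g e) xs y"
  using assms(1)
proof (induction rule: ev.induct)
  case (ev_Orc x xs)
  show ?case
    by (auto intro!: ev.ev_Cm[where ys = "[x]"] g ev_Pj[of 0 "x # xs", simplified])
next
  case (ev_Cm xs gs ys h z)
  then show ?case
    by (auto intro!: ev.ev_Cm[where ys = ys] simp: list.rel_map elim: list_all2_mono)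
next
  case (ev_Mn g n xs)
  then show ?case by (auto intro!: ev.ev_Mn)
qed (auto intro: ev.intros)

text \<open>Used to simulate a computation on \<open>p\<close> when the oracle is a pair that has
  \<open>p\<close> as its even half.\<close>

lemma computable_change_oracle:
  assumes "computable n F" "computable 1 (\<lambda>p xs. h p (xs ! 0))"
  shows "computable n (\<lambda>p xs. F (h p) xs)"
proof -
  obtain e g where e: "\<And>p xs. length xs = n \<Longrightarrow> ev p e xs (F p xs)"
    and g: "\<And>p xs. length xs = 1 \<Longrightarrow> ev p g xs (h p (xs ! 0))"
    using assms unfolding computable_def by blast
  have "ev p (oracle_subst g e) xs (F (h p) xs)" if "length xs = n" for p xs
    by (rule ev_oracle_subst[OF e[OF that]]) (use g[of "[_]"] in simp)
  then show ?thesis unfolding computable_def by blast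
qed

text \<open>The oracle and the result are approximations: \<open>0\<close> means that no value is known yet, and
  \<open>Suc v\<close> that the value is \<open>v\<close>. The bound \<open>s\<close> only limits the unbounded searches. In the search
  case at most one summand is nonzero.\<close>

fun approx :: "(nat \<Rightarrow> nat) \<Rightarrow> nat \<Rightarrow> rf \<Rightarrow> nat list \<Rightarrow> nat" where
  "approx o' s Zr xs = 1"
| "approx o' s Sc xs = (if xs = [] then 0 else Suc (Suc (xs ! 0)))"
| "approx o' s (Pj i) xs = (if i < length xs then Suc (xs ! i) else 0)"
| "approx o' s Orc xs = (if xs = [] then 0 else o' (xs ! 0))"
| "approx o' s (Cm h gs) xs =
     (if \<exists>g\<in>set gs. approx o' s g xs = 0 then 0
      else approx o' s h (map (\<lambda>g. approx o' s g xs - 1) gs))"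
| "approx o' s (Pr g h) xs =
     (case xs of [] \<Rightarrow> 0
      | n # zs \<Rightarrow> rec_nat (approx o' s g zs)
          (\<lambda>m y. if y = 0 then 0 else approx o' s h (m # (y - 1) # zs)) n)"
| "approx o' s (Mn g) xs =
     (\<Sum>n<s. if approx o' s g (n # xs) = 1 \<and> (\<forall>m<n. 1 < approx o' s g (m # xs)) then Suc n else 0)"

text \<open>Unknown intermediate values propagate to \<open>0\<close>, so a nonzero result rests on
  known oracle values alone.\<close>

lemma approx_sound:
  assumes o': "\<And>x v. o' x = Suc v \<Longrightarrow> f x = v"
  shows "approx o' s e xs = Suc y \<Longrightarrow> ev f e xs y"
proof (induction e arbitrary: xs y)
  case Sc
  then show ?case by (cases xs) (auto intro: ev.intros split: if_splits)
next
  case Orc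
  then show ?case using o' by (cases xs) (auto intro: ev_Orc split: if_splits)
next
  case (Cm h gs)
  from Cm.prems have nz: "\<And>g. g \<in> set gs \<Longrightarrow> approx o' s g xs \<noteq> 0"
    and h: "approx o' s h (map (\<lambda>g. approx o' s g xs - 1) gs) = Suc y"
    by (auto split: if_splits)
  show ?case
  proof (rule ev_Cm)
    show "list_all2 (\<lambda>g. ev f g xs) gs (map (\<lambda>g. approx o' s g xs - 1) gs)"
      using nz Cm.IH(2) by (auto simp: list_all2_conv_all_nth)
  qed (rule Cm.IH(1)[OF h])
next
  case (Pr g h)
  then obtain n zs where xs: "xs = n # zs" by (cases xs) auto
  have "rec_nat (approx o' s g zs)
      (\<lambda>m y. if y = 0 then 0 else approx o' s h (m # (y - 1) # zs)) n = Suc y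
    \<Longrightarrow> ev f (rf.Pr g h) (n # zs) y" for y
  proof (induction n arbitrary: y)
    case 0
    then show ?case using Pr.IH(1) by (auto intro: ev_Pr0)
  next
    case (Suc n)
    let ?r = "rec_nat (approx o' s g zs)
      (\<lambda>m y. if y = 0 then 0 else approx o' s h (m # (y - 1) # zs)) n"
    from Suc.prems obtain v where v: "?r = Suc v" by (cases ?r) auto
    with Suc.prems have "approx o' s h (n # v # zs) = Suc y" by simp
    then show ?case using Suc.IH[OF v] Pr.IH(2) by (auto intro: ev_PrS)
  qed
  then show ?case using Pr.prems xs by simp
next
  case (Mn g)
  let ?P = "\<lambda>n. approx o' s g (n # xs) = 1 \<and> (\<forall>m<n. 1 < approx o' s g (m # xs))"
  have "\<exists>n<s. ?P n"
  proof (rule ccontr)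
    assume "\<not> (\<exists>n<s. ?P n)"
    then have "approx o' s (rf.Mn g) xs = (\<Sum>n<s. 0)"
      unfolding approx.simps by (intro sum.cong refl if_not_P) blast
    with Mn.prems show False by simp
  qed
  then obtain n where n: "n < s" "?P n" by blast
  have "approx o' s (rf.Mn g) xs = (\<Sum>i<s. if i = n then Suc n else 0)"
  proof -
    \<comment> \<open>A smaller \<open>i\<close> has a value above \<open>1\<close>, and a larger
      \<open>i\<close> would require one at \<open>n\<close>.\<close>
    have "?P i \<longleftrightarrow> i = n" for i
      using n(2) by (cases i n rule: linorder_cases) auto
    then show ?thesis unfolding approx.simps by (intro sum.cong refl) simp
  qed
  with n Mn.prems have y: "y = n" by simp
  show ?case unfolding y
  proof (rule ev_Mn)
    show "ev f g (n # xs) 0" using n Mn.IH by simp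
    show "\<forall>m<n. \<exists>y. y \<noteq> 0 \<and> ev f g (m # xs) y"
    proof (intro allI impI)
      fix m assume "m < n"
      then have "1 < approx o' s g (m # xs)" using n by blast
      then show "\<exists>y. y \<noteq> 0 \<and> ev f g (m # xs) y"
        using Mn.IH[of "m # xs" "approx o' s g (m # xs) - 1"]
        by (intro exI[of _ "approx o' s g (m # xs) - 1"]) auto
    qed
  qed
qed (auto intro: ev.intros split: if_splits)

text \<open>A terminating evaluation makes finitely many queries and searches, and finitely many
  eventual conditions hold together from some stage on.\<close>

lemma approx_complete:
  assumes o': "\<And>x. \<forall>\<^sub>F s in sequentially. o' s x = Suc (f x)"
  shows "ev f e xs y \<Longrightarrow> \<forall>\<^sub>F s in sequentially. approx (o' s) s e xs = Suc y"
proof (induction rule: ev.induct)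
  case (ev_Orc x xs)
  then show ?case using o' by simp
next
  case (ev_Cm xs gs ys h z)
  have "\<forall>\<^sub>F s in sequentially. \<forall>i\<in>{..<length gs}. approx (o' s) s (gs ! i) xs = Suc (ys ! i)"
    using ev_Cm.IH(1) by (auto simp: list_all2_conv_all_nth intro!: eventually_ball_finite)
  with ev_Cm.IH(2) show ?case
  proof eventually_elim
    case (elim s)
    then have "\<forall>g\<in>set gs. approx (o' s) s g xs \<noteq> 0"
      by (auto simp: in_set_conv_nth)
    moreover have "map (\<lambda>g. approx (o' s) s g xs - 1) gs = ys"
      using elim ev_Cm.IH(1) by (auto simp: list_all2_conv_all_nth intro!: nth_equalityI)
    ultimately show ?case using elim by auto
  qed
next
  case (ev_PrS g h n xs y z)
  from ev_PrS.IH show ?case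
    by eventually_elim auto
next
  case (ev_Mn g n xs)
  have "\<forall>\<^sub>F s in sequentially. \<forall>m\<in>{..<n}. 1 < approx (o' s) s g (m # xs)"
  proof (intro eventually_ball_finite ballI)
    fix m assume "m \<in> {..<n}"
    then obtain y where "y \<noteq> 0" "\<forall>\<^sub>F s in sequentially. approx (o' s) s g (m # xs) = Suc y"
      using ev_Mn.IH(2) by auto
    then show "\<forall>\<^sub>F s in sequentially. 1 < approx (o' s) s g (m # xs)"
      by (auto elim: eventually_mono)
  qed simp
  \<comment> \<open>The bound \<open>s\<close> must exceed \<open>n\<close>, or the bounded search
    would stop before the zero.\<close>
  with ev_Mn.IH(1) eventually_gt_at_top[of n] show ?case
  proof eventually_elim
    case (elim s)
    then have "approx (o' s) s g (i # xs) = 1 \<and> (\<forall>m<i. 1 < approx (o' s) s g (m # xs)) \<longleftrightarrow> i = n" for i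
      by (cases i n rule: linorder_cases) force+
    then have "approx (o' s) s (Mn g) xs = (\<Sum>i<s. if i = n then Suc n else 0)"
      unfolding approx.simps by (intro sum.cong refl) simp
    then show ?case using elim by simp
  qed
qed auto

text \<open>With the true oracle, the function \<open>approx\<close> eventually returns every value
  that the relation allows, and a function has one value at a time.\<close>

lemma ev_deterministic: "ev f e xs y \<Longrightarrow> ev f e xs y' \<Longrightarrow> y = y'"
proof -
  assume "ev f e xs y" "ev f e xs y'"
  then have "\<forall>\<^sub>F s in sequentially. approx (\<lambda>x. Suc (f x)) s e xs = Suc y
      \<and> approx (\<lambda>x. Suc (f x)) s e xs = Suc y'"
    by (intro eventually_conj approx_complete) auto
  from eventually_happens'[OF sequentially_bot this] show "y = y'" by auto
qed

lemma tf_eq_Some_iff: "tf e p = Some g \<longleftrightarrow> (\<forall>n. ev p e [n] (g n))"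
proof
  assume L: "tf e p = Some g"
  show "\<forall>n. ev p e [n] (g n)"
  proof
    fix n
    from L have g: "g = (\<lambda>n. THE y. ev p e [n] y)"
      unfolding tf_def by (auto split: if_splits)
    obtain y where y: "ev p e [n] y" using L unfolding tf_def by (auto split: if_splits)
    have "(THE y. ev p e [n] y) = y"
      using y by (rule the_equality) (rule ev_deterministic[OF _ y])
    with y g show "ev p e [n] (g n)" by simp
  qed
next
  assume R: "\<forall>n. ev p e [n] (g n)"
  have "(THE y. ev p e [n] y) = g n" for n
    using R by (intro the_equality) (auto intro: ev_deterministic)
  with R show "tf e p = Some g"
    unfolding tf_def by auto
qed

text \<open>The simulated program is fixed rather than an input, so induction on \<open>e\<close>
  replaces a universal machine. The first \<open>m\<close> entries are arguments of the simulation,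
  the last \<open>q\<close> are parameters of the oracle and of the bound; \<open>m\<close> varies
  because \<open>Cm\<close>, \<open>Pr\<close> and \<open>Mn\<close> change the number of
  arguments.\<close>

lemma computable_approx_list:
  assumes O: "computable (Suc q) O'" and S: "computable q S"
  shows "computable (m + q)
    (\<lambda>p zs. approx (\<lambda>x. O' p (x # drop m zs)) (S p (drop m zs)) e (take m zs))"
proof (induction e arbitrary: m)
  case Zr
  show ?case by (auto intro: computable_const)
next
  case Sc
  show ?case
  proof (cases m)
    case (Suc k)
    show ?thesis
      by (rule computable_cong[OF computable_Suc[OF computable_Suc[OF computable_nth[of 0]]]])
         (auto simp: Suc)
  qed (auto intro: computable_const)
next
  case (Pj i)
  show ?case
  proof (cases "i < m")
    case True
    then show ?thesis
      by (intro computable_cong[OF computable_Suc[OF computable_nth[of i]]]) auto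
  next
    case False
    show ?thesis
      by (rule computable_cong[OF computable_zero]) (use False in auto)
  qed
next
  case Orc
  show ?case
  proof (cases m)
    case (Suc k)
    have "computable (m + q) (\<lambda>p xs. O' p (map (\<lambda>G. G p xs)
        ((\<lambda>p xs. xs ! 0) # map (\<lambda>i p xs. xs ! (m + i)) [0..<q])))"
      by (rule computable_compose_list) (use O computable_nth Suc in auto)
    then show ?thesis
    proof (rule computable_cong)
      fix p :: "nat \<Rightarrow> nat" and xs :: "nat list" assume l: "length xs = m + q"
      then have "map (\<lambda>G. G p xs) (map (\<lambda>i p xs. xs ! (m + i)) [0..<q]) = drop m xs"
        by (intro nth_equalityI) auto
      then show "O' p (map (\<lambda>G. G p xs) ((\<lambda>p xs. xs ! 0) # map (\<lambda>i p xs. xs ! (m + i)) [0..<q])) =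
        approx (\<lambda>x. O' p (x # drop m xs)) (S p (drop m xs)) Orc (take m xs)"
        using l Suc by auto
    qed
  qed (auto intro: computable_const)
next
  case (Cm h gs)
  define A where "A = (\<lambda>g p zs. approx (\<lambda>x. O' p (x # drop m zs)) (S p (drop m zs)) g (take m zs))"
  have A: "computable (m + q) (A g)" if "g \<in> set gs" for g
    using Cm.IH(2)[OF that] by (simp add: A_def)
  have dec: "decidable (m + q) (\<lambda>p zs. \<exists>g\<in>set gs. A g p zs = 0)"
    using A
  proof (induction gs)
    case Nil
    then show ?case by (simp add: decidable_def computable_zero)
  next
    case (Cons g gs)
    then show ?case by (auto intro!: decidable_disj decidable_eq_zero)
  qed
  have "computable (m + q) (\<lambda>p xs.
     (\<lambda>p zs. approx (\<lambda>x. O' p (x # drop (length gs) zs)) (S p (drop (length gs) zs)) h (take (length gs) zs)) p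
      (map (\<lambda>G. G p xs) (map (\<lambda>g p zs. A g p zs - 1) gs @ map (\<lambda>i p xs. xs ! (m + i)) [0..<q])))"
    by (rule computable_compose_list)
       (use Cm.IH(1)[of "length gs"] A computable_nth in \<open>auto intro!: computable_diff computable_const\<close>)
  from computable_if[OF dec computable_zero this] show ?case
  proof (rule computable_cong)
    fix p :: "nat \<Rightarrow> nat" and xs :: "nat list" assume l: "length xs = m + q"
    then have "map (\<lambda>G. G p xs) (map (\<lambda>i p xs. xs ! (m + i)) [0..<q]) = drop m xs"
      by (intro nth_equalityI) auto
    moreover have "map (\<lambda>G. G p xs) (map (\<lambda>g p zs. A g p zs - 1) gs) = map (\<lambda>g. A g p xs - 1) gs"
      by simp
    ultimately show "(if \<exists>g\<in>set gs. A g p xs = 0 then 0 else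
     (\<lambda>p zs. approx (\<lambda>x. O' p (x # drop (length gs) zs)) (S p (drop (length gs) zs)) h (take (length gs) zs)) p
      (map (\<lambda>G. G p xs) (map (\<lambda>g p zs. A g p zs - 1) gs @ map (\<lambda>i p xs. xs ! (m + i)) [0..<q])))
      = approx (\<lambda>x. O' p (x # drop m xs)) (S p (drop m xs)) (rf.Cm h gs) (take m xs)"
      by (auto simp: A_def simp del: map_map)
  qed
next
  case (Pr g h)
  show ?case
  proof (cases m)
    case 0
    then show ?thesis by (auto intro: computable_const)
  next
    case (Suc k)
    let ?G = "\<lambda>p zs. approx (\<lambda>x. O' p (x # drop k zs)) (S p (drop k zs)) g (take k zs)"
    let ?H = "\<lambda>p zs. approx (\<lambda>x. O' p (x # drop (k + 2) zs)) (S p (drop (k + 2) zs)) h (take (k + 2) zs)"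
    have G: "computable (m + q) (\<lambda>p zs. ?G p (drop 1 zs))"
      by (rule computable_drop[OF Pr.IH(1)[of k]]) (simp add: Suc)
    have H: "computable (Suc (Suc (m + q)))
       (\<lambda>p ys. if ys ! 1 = 0 then 0 else ?H p (ys ! 0 # (ys ! 1 - 1) # drop 1 (drop 2 ys)))"
    proof -
      \<comment> \<open>Index \<open>3 + i\<close> skips the counter, the previous value and the
        recursion argument at the head of the outer list.\<close>
      have "computable (Suc (Suc (m + q))) (\<lambda>p xs. ?H p (map (\<lambda>G. G p xs)
         ((\<lambda>p ys. ys ! 0) # (\<lambda>p ys. ys ! 1 - 1) # map (\<lambda>i p ys. ys ! (3 + i)) [0..<k + q])))"
        by (rule computable_compose_list)
           (use Pr.IH(2)[of "k + 2"] in \<open>auto simp: Suc intro!: computable_intros\<close>)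
      from computable_if[OF decidable_eq[OF computable_nth[of 1] computable_zero] computable_zero this]
      show ?thesis
      proof (rule computable_cong)
        fix p :: "nat \<Rightarrow> nat" and xs :: "nat list" assume l: "length xs = Suc (Suc (m + q))"
        then have "map (\<lambda>G. G p xs) (map (\<lambda>i p xs. xs ! (3 + i)) [0..<k + q]) = drop 1 (drop 2 xs)"
          by (intro nth_equalityI) (auto simp: Suc numeral_3_eq_3)
        then show "(if xs ! 1 = 0 then 0 else ?H p (map (\<lambda>G. G p xs)
         ((\<lambda>p ys. ys ! 0) # (\<lambda>p ys. ys ! 1 - 1) # map (\<lambda>i p ys. ys ! (3 + i)) [0..<k + q])))
         = (if xs ! 1 = 0 then 0 else ?H p (xs ! 0 # (xs ! 1 - 1) # drop 1 (drop 2 xs)))"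
          by (simp del: map_map drop_drop)
      qed simp
    qed
    have "computable (m + q) (\<lambda>p xs. rec_nat (?G p (drop 1 xs))
       (\<lambda>i y. if y = 0 then 0 else ?H p (i # (y - 1) # drop 1 xs)) (xs ! 0))"
      by (rule computable_rec_nat[OF G H computable_nth]) (simp add: Suc)
    then show ?thesis
    proof (rule computable_cong)
      fix p :: "nat \<Rightarrow> nat" and xs :: "nat list" assume "length xs = m + q"
      then obtain a zs where "xs = a # zs" "length zs = k + q" by (cases xs) (auto simp: Suc)
      then show "rec_nat (?G p (drop 1 xs))
       (\<lambda>i y. if y = 0 then 0 else ?H p (i # (y - 1) # drop 1 xs)) (xs ! 0) =
        approx (\<lambda>x. O' p (x # drop m xs)) (S p (drop m xs)) (rf.Pr g h) (take m xs)"
        by (simp add: Suc cong: if_cong)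
    qed
  qed
next
  case (Mn g)
  define G where "G = (\<lambda>p zs. approx (\<lambda>x. O' p (x # drop (Suc m) zs)) (S p (drop (Suc m) zs)) g (take (Suc m) zs))"
  have G: "computable (Suc (m + q)) G"
    using Mn.IH[of "Suc m"] by (simp add: G_def)
  have G0: "computable (Suc (m + q)) (\<lambda>p ys. G p (ys ! 0 # drop 1 ys))"
    by (rule computable_cong[OF G]) (auto simp: length_Suc_conv)
  have G1: "computable (Suc (Suc (m + q))) (\<lambda>p ys. G p (ys ! 0 # drop 1 (drop 1 ys)))"
  proof -
    have "computable (2 + (m + q)) (\<lambda>p ys. G p (ys ! 0 # drop 2 ys))"
      by (rule computable_compose_drop[where G = "\<lambda>p x xs. G p (x # xs)"]) (use G0 computable_nth in simp_all)
    then show ?thesis by (simp add: numeral_2_eq_2)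
  qed
  have "computable (m + q) (\<lambda>p xs. \<Sum>n<S p (drop m xs).
      if G p (n # xs) = 1 \<and> (\<forall>i<n. 1 < G p (i # xs)) then Suc n else 0)"
    by (intro computable_sum computable_if decidable_conj decidable_eq decidable_all_less
        decidable_less G0 G1 computable_const computable_nth computable_Suc computable_drop[OF S]) auto
  then show ?case by (rule computable_cong) (auto simp: G_def)
qed

lemma computable_approx:
  assumes "computable (Suc q) (\<lambda>p ys. O' p (ys ! 0) (drop 1 ys))" "computable q S" "computable q X"
  shows "computable q (\<lambda>p xs. approx (\<lambda>x. O' p x xs) (S p xs) e [X p xs])"
proof -
  let ?H = "\<lambda>p zs. approx (\<lambda>x. O' p x (drop 1 zs)) (S p (drop 1 zs)) e (take 1 zs)"
  have H: "computable (length (X # map (\<lambda>i p xs. xs ! i) [0..<q])) ?H"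
    using computable_approx_list[OF assms(1,2), of 1 e] by simp
  have "computable q (\<lambda>p xs. ?H p (map (\<lambda>G. G p xs) (X # map (\<lambda>i p xs. xs ! i) [0..<q])))"
    by (rule computable_compose_list[OF H]) (use assms(3) computable_nth in auto)
  then show ?thesis
  proof (rule computable_cong)
    fix p :: "nat \<Rightarrow> nat" and xs :: "nat list" assume l: "length xs = q"
    then have "map (\<lambda>G. G p xs) (map (\<lambda>i p xs. xs ! i) [0..<q]) = xs"
      by (intro nth_equalityI) auto
    then show "approx (\<lambda>x. O' p x (drop 1 (map (\<lambda>G. G p xs) (X # map (\<lambda>i p xs. xs ! i) [0..<q]))))
      (S p (drop 1 (map (\<lambda>G. G p xs) (X # map (\<lambda>i p xs. xs ! i) [0..<q])))) e
      (take 1 (map (\<lambda>G. G p xs) (X # map (\<lambda>i p xs. xs ! i) [0..<q])))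
      = approx (\<lambda>x. O' p x xs) (S p xs) e [X p xs]"
      by (simp del: map_map)
  qed
qed

text \<open>The second fact makes halting equivalent to the existence of a zero, which is the form
  that \<open>ce\<close> asks for.\<close>

lemma computable_LEAST:
  assumes "computable (Suc n) (\<lambda>p ys. B p (ys ! 0) (drop 1 ys))"
  obtains e where "\<And>p xs s. length xs = n \<Longrightarrow> B p s xs = 0 \<Longrightarrow> ev p e xs (LEAST s. B p s xs = 0)"
    and "\<And>p xs y. length xs = n \<Longrightarrow> ev p e xs y \<Longrightarrow> B p y xs = 0"
proof -
  from assms obtain b where b: "\<And>p ys. length ys = Suc n \<Longrightarrow> ev p b ys (B p (ys ! 0) (drop 1 ys))"
    unfolding computable_def by blast
  have b': "ev p b (s # xs) (B p s xs)" if "length xs = n" for p s xs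
    using b[of "s # xs"] that by simp
  show thesis
  proof
    fix p xs s assume l: "length xs = n" and s: "B p s xs = 0"
    show "ev p (Mn b) xs (LEAST s. B p s xs = 0)"
    proof (rule ev_Mn)
      show "ev p b ((LEAST s. B p s xs = 0) # xs) 0"
        using b'[OF l, of p "LEAST s. B p s xs = 0"] LeastI[of "\<lambda>s. B p s xs = 0", OF s] by simp
      show "\<forall>m<LEAST s. B p s xs = 0. \<exists>y. y \<noteq> 0 \<and> ev p b (m # xs) y"
        using b'[OF l] not_less_Least by blast
    qed
  next
    fix p xs y assume l: "length xs = n" and e: "ev p (Mn b) xs y"
    from e have "ev p b (y # xs) 0" by cases auto
    from ev_deterministic[OF b'[OF l] this] show "B p y xs = 0" .
  qed
qed

text \<open>The value is read off at the first stage where one is known; known values agree, so the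
  choice of stage is harmless. Convergence is assumed only for the oracle at hand, so one code
  serves all oracles although many of them may give no total result.\<close>

lemma tf_from_approx:
  assumes "computable 2 (\<lambda>p ys. B p (ys ! 0) (ys ! 1))"
  obtains e where "\<And>p g. (\<And>s n. B p s n \<in> {0, Suc (g n)}) \<Longrightarrow> (\<And>n. \<exists>s. B p s n \<noteq> 0) \<Longrightarrow> tf e p = Some g"
proof -
  \<comment> \<open>\<open>Mn\<close> searches for a zero, whereas a known value is nonzero;
    \<open>of_bool\<close> swaps the two.\<close>
  have "computable (Suc 1) (\<lambda>p ys. (\<lambda>p s xs. of_bool (B p s (xs ! 0) = 0)) p (ys ! 0) (drop 1 ys))"
    by (intro computable_intros computable_compose2[OF assms]) auto
  then obtain e where e: "\<And>p xs s. length xs = 1 \<Longrightarrow> of_bool (B p s (xs ! 0) = 0) = (0 :: nat) \<Longrightarrow>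
      ev p e xs (LEAST s. of_bool (B p s (xs ! 0) = 0) = (0 :: nat))"
    by (rule computable_LEAST[of 1 "\<lambda>p s xs. of_bool (B p s (xs ! 0) = 0)"]) (simp, blast)
  have "computable 2 (\<lambda>p ys. B p (ys ! 0) (ys ! 1) - 1)"
    by (intro computable_intros assms)
  then obtain d where d: "\<And>p ys. length ys = 2 \<Longrightarrow> ev p d ys (B p (ys ! 0) (ys ! 1) - 1)"
    unfolding computable_def by blast
  show thesis
  proof (rule that[of "Cm d [e, Pj 0]"])
    fix p g assume B: "\<And>s n. B p s n \<in> {0, Suc (g n)}" and ex: "\<And>n. \<exists>s. B p s n \<noteq> 0"
    show "tf (Cm d [e, Pj 0]) p = Some g"
      unfolding tf_eq_Some_iff
    proof
      fix n
      let ?L = "LEAST s. of_bool (B p s n = 0) = (0 :: nat)"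
      obtain s where "B p s n \<noteq> 0" using ex by blast
      then have 1: "ev p e [n] ?L" using e[of "[n]" p s] by simp
      have "B p ?L n \<noteq> 0"
        using LeastI[of "\<lambda>s. of_bool (B p s n = 0) = (0::nat)" s] \<open>B p s n \<noteq> 0\<close> by auto
      with B[of ?L n] have "B p ?L n - 1 = g n" by auto
      with d[of "[?L, n]" p] have "ev p d [?L, n] (g n)" by simp
      with 1 show "ev p (Cm d [e, Pj 0]) [n] (g n)"
        by (intro ev_Cm[where ys = "[?L, n]"]) (auto intro: ev_Pj[of 0 "[n]", simplified])
    qed
  qed
qed

section \<open>Tests on Cantor space\<close>

abbreviation flip :: "nat \<Rightarrow> (nat \<Rightarrow> bool) \<Rightarrow> nat \<Rightarrow> bool" where
  "flip n X \<equiv> X(n := \<not> X n)"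

lemma vimage_flip_flip [simp]: "flip n -` (flip n -` A) = A"
  by auto

lemma measurable_flip: "flip n \<in> measurable lebC lebC"
  unfolding lebC_def
proof (rule measurable_PiM_single')
  let ?M = "\<lambda>i :: nat. measure_pmf (bernoulli_pmf (1/2))"
  fix i
  have "(\<lambda>X. X i) \<in> measurable (PiM UNIV ?M) (?M i)" by simp
  moreover have "Not \<in> measurable (?M i) (?M i)" by simp
  ultimately have "(\<lambda>X. \<not> X i) \<in> measurable (PiM UNIV ?M) (?M i)"
    by (rule measurable_compose)
  with \<open>(\<lambda>X. X i) \<in> _\<close> show "(\<lambda>X. flip n X i) \<in> measurable (PiM UNIV ?M) (?M i)"
    by (cases "i = n") auto
qed auto

text \<open>A product measure is determined by its values on finite boxes. Flipping alters at most
  one side of a box, and the mass of a fair coin is invariant under negation.\<close>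

lemma distr_lebC_flip: "distr lebC lebC (flip n) = lebC"
proof -
  define M where "M = (\<lambda>i :: nat. measure_pmf (bernoulli_pmf (1/2)))"
  have lebC: "lebC = PiM UNIV M" by (simp add: lebC_def M_def)
  have sets: "A \<in> sets (M i)" for A i by (simp add: M_def)
  have pm: "prob_space (M i)" for i by (simp add: M_def measure_pmf.prob_space_axioms)
  note meas = measurable_flip[of n, unfolded lebC]
  have neg: "emeasure (M i) (Not -` A) = emeasure (M i) A" for i A
  proof -
    have "map_pmf Not (bernoulli_pmf (1/2)) = bernoulli_pmf (1/2 :: real)"
    proof (rule pmf_eqI)
      fix b
      have "Not -` {b} = {\<not> b}" by auto
      then show "pmf (map_pmf Not (bernoulli_pmf (1/2))) b = pmf (bernoulli_pmf (1/2)) b"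
        by (cases b) (simp_all add: pmf_map measure_pmf_single)
    qed
    then have "emeasure (measure_pmf (map_pmf Not (bernoulli_pmf (1/2)))) A = emeasure (M i) A"
      by (simp add: M_def)
    then show ?thesis by (simp add: M_def)
  qed
  have "PiM UNIV M = distr (PiM UNIV M) (PiM UNIV M) (flip n)"
  proof (rule measure_eqI_PiM_infinite[OF refl])
    show "sets (distr (PiM UNIV M) (PiM UNIV M) (flip n)) = sets (PiM UNIV M)" by simp
    show "finite_measure (PiM UNIV M)"
      by (intro prob_space.finite_measure prob_space_PiM pm)
    fix J :: "nat set" and A assume J: "finite J"
    let ?A = "\<lambda>i. if i = n then Not -` A i else A i"
    have "flip n -` prod_emb UNIV M J (Pi\<^sub>E J A) \<inter> space (PiM UNIV M) = prod_emb UNIV M J (Pi\<^sub>E J ?A)"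
      by (auto simp: prod_emb_def space_PiM M_def Pi_iff PiE_iff split: if_splits)
    then have "emeasure (distr (PiM UNIV M) (PiM UNIV M) (flip n)) (prod_emb UNIV M J (Pi\<^sub>E J A))
      = emeasure (PiM UNIV M) (prod_emb UNIV M J (Pi\<^sub>E J ?A))"
      using J sets by (subst emeasure_distr) (auto intro!: meas sets_PiM_I)
    also have "\<dots> = (\<Prod>i\<in>J. emeasure (M i) (?A i))"
      by (intro emeasure_PiM_emb pm sets J) auto
    also have "\<dots> = (\<Prod>i\<in>J. emeasure (M i) (A i))"
      by (intro prod.cong refl) (simp add: neg)
    also have "\<dots> = emeasure (PiM UNIV M) (prod_emb UNIV M J (Pi\<^sub>E J A))"
      by (intro emeasure_PiM_emb[symmetric] pm sets J) auto
    finally show "emeasure (PiM UNIV M) (prod_emb UNIV M J (Pi\<^sub>E J A)) =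
      emeasure (distr (PiM UNIV M) (PiM UNIV M) (flip n)) (prod_emb UNIV M J (Pi\<^sub>E J A))" ..
  qed
  then show ?thesis by (simp add: lebC)
qed

lemma emeasure_vimage_flip: "emeasure lebC (flip n -` V) = emeasure lebC V"
proof -
  note meas = measurable_flip[of n]
  have space: "space lebC = UNIV" by (simp add: lebC_def space_PiM PiE_def)
  show ?thesis
  proof (cases "V \<in> sets lebC")
    case True
    then have "emeasure (distr lebC lebC (flip n)) V = emeasure lebC (flip n -` V)"
      by (simp add: emeasure_distr[OF meas] space)
    then show ?thesis by (simp add: distr_lebC_flip)
  next
    \<comment> \<open>A set outside the sigma-algebra has \<open>emeasure\<close> zero by default;
      the flip, being a measurable involution, keeps it outside.\<close>
    case False
    have "flip n -` V \<notin> sets lebC"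
    proof
      assume "flip n -` V \<in> sets lebC"
      then have "flip n -` (flip n -` V) \<in> sets lebC"
        using measurable_sets[OF meas, of "flip n -` V"] space by simp
      then show False using False by simp
    qed
    then show ?thesis using False by (simp add: emeasure_notin_sets)
  qed
qed

lemma emeasure_cyl_replicate: "emeasure lebC (cyl (replicate n b)) = ennreal ((1/2) ^ n)"
proof -
  let ?M = "\<lambda>i :: nat. measure_pmf (bernoulli_pmf (1/2))"
  have cyl: "cyl (replicate n b) = prod_emb UNIV ?M {..<n} (Pi\<^sub>E {..<n} (\<lambda>_. {b}))"
    by (auto simp: cyl_def prod_emb_def fun_eq_iff restrict_def split: if_splits)
  have "emeasure lebC (cyl (replicate n b)) = (\<Prod>i<n. emeasure (?M i) {b})"
    unfolding lebC_def cyl by (rule emeasure_PiM_emb) (auto simp: measure_pmf.prob_space_axioms)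
  also have "emeasure (measure_pmf (bernoulli_pmf (1/2))) {b} = ennreal (1/2)"
    by (cases b) (simp_all add: emeasure_pmf_single)
  also have "(\<Prod>i<n. ennreal (1/2)) = ennreal (1/2) ^ n"
    by (simp only: prod_constant card_lessThan)
  also have "ennreal (1/2) ^ n = ennreal ((1/2) ^ n)"
    by (rule ennreal_power) simp
  finally show ?thesis .
qed

lemma cyl_subset_iff: "cyl \<sigma> \<subseteq> cyl \<tau> \<longleftrightarrow> take (length \<tau>) \<sigma> = \<tau>"
proof
  assume sub: "cyl \<sigma> \<subseteq> cyl \<tau>"
  \<comment> \<open>Beyond the end of \<open>\<sigma>\<close> the filler \<open>d\<close> is free;
    its two values together show that \<open>\<tau>\<close> cannot be longer.\<close>
  have X: "(\<lambda>k. if k < length \<sigma> then \<sigma> ! k else d) \<in> cyl \<tau>" for d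
    by (rule subsetD[OF sub]) (simp add: cyl_def)
  have nth: "\<tau> ! k = (if k < length \<sigma> then \<sigma> ! k else d)" if "k < length \<tau>" for k d
    using X[of d] that by (simp add: cyl_def)
  have "length \<tau> \<le> length \<sigma>"
  proof (rule ccontr)
    assume "\<not> ?thesis"
    then show False
      using nth[of "length \<sigma>" True] nth[of "length \<sigma>" False] by simp
  qed
  then show "take (length \<tau>) \<sigma> = \<tau>"
    using nth by (intro nth_equalityI) simp_all
next
  assume *: "take (length \<tau>) \<sigma> = \<tau>"
  have "length \<tau> \<le> length \<sigma>"
    using arg_cong[OF *, of length] by simp
  moreover have "\<sigma> ! k = \<tau> ! k" if "k < length \<tau>" for k
    using arg_cong[OF *, of "\<lambda>l. l ! k"] that by simp
  ultimately show "cyl \<sigma> \<subseteq> cyl \<tau>" unfolding cyl_def by fastforce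
qed

lemma cyl_take: "X \<in> cyl (map X [0..<n])"
  by (simp add: cyl_def)

lemma ce_many_one:
  assumes ce: "ce A" and f: "computable 1 (\<lambda>p xs. f (xs ! 0))" and B: "\<And>n. n \<in> B \<longleftrightarrow> f n \<in> A"
  shows "ce B"
proof -
  from ce obtain a where a: "\<And>n. n \<in> A \<longleftrightarrow> (\<exists>y. ev (\<lambda>_. 0) a [n] y)" unfolding ce_def by blast
  from f obtain e where f': "\<And>p xs. length xs = 1 \<Longrightarrow> ev p e xs (f (xs ! 0))" unfolding computable_def by blast
  have e: "ev p e [n] (f n)" for p n using f'[of "[n]"] by simp
  have "(\<exists>y. ev (\<lambda>_. 0) (Cm a [e]) [n] y) \<longleftrightarrow> (\<exists>y. ev (\<lambda>_. 0) a [f n] y)" for n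
  proof
    assume "\<exists>y. ev (\<lambda>_. 0) (Cm a [e]) [n] y"
    then obtain y where "ev (\<lambda>_. 0) (Cm a [e]) [n] y" by blast
    then obtain m where "ev (\<lambda>_. 0) e [n] m" "ev (\<lambda>_. 0) a [m] y"
      by cases (auto simp: list_all2_Cons1)
    with ev_deterministic[OF e] show "\<exists>y. ev (\<lambda>_. 0) a [f n] y" by blast
  next
    assume "\<exists>y. ev (\<lambda>_. 0) a [f n] y"
    then obtain y where "ev (\<lambda>_. 0) a [f n] y" ..
    then have "ev (\<lambda>_. 0) (Cm a [e]) [n] y" using e by (intro ev_Cm[where ys = "[f n]"]) auto
    then show "\<exists>y. ev (\<lambda>_. 0) (Cm a [e]) [n] y" ..
  qed
  with B a show ?thesis unfolding ce_def by blast
qed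

text \<open>Entries above \<open>1\<close> stay fixed, which makes this an involution on all lists
  and not only on those that represent binary strings. Membership in a test can then be transferred
  both ways for an arbitrary number.\<close>

fun flip_nth :: "nat \<Rightarrow> nat list \<Rightarrow> nat list" where
  "flip_nth n [] = []"
| "flip_nth 0 (x # l) = (if x = 0 then 1 else if x = 1 then 0 else x) # l"
| "flip_nth (Suc n) (x # l) = x # flip_nth n l"

lemma list_decode_cases:
  "list_decode m = (if m = 0 then [] else fst (prod_decode (m - 1)) # list_decode (snd (prod_decode (m - 1))))"
  by (cases m) (auto split: prod.split)

text \<open>The position \<open>n\<close> is fixed, so the induction builds one program for each
  \<open>n\<close>, without recursion along the list.\<close>

lemma computable_flip_nth:
  "computable 1 (\<lambda>p xs. list_encode (flip_nth n (list_decode (xs ! 0))))"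
proof (induction n)
  case 0
  have "list_encode (flip_nth 0 (list_decode m)) =
    (if m = 0 then 0 else Suc (prod_encode (let x = fst (prod_decode (m - 1)) in
        if x = 0 then 1 else if x = 1 then 0 else x, snd (prod_decode (m - 1)))))" for m
    by (subst list_decode_cases) (auto simp: Let_def)
  then show ?case
    by (simp only: Let_def) (intro computable_intros; simp)
next
  case (Suc n)
  have "list_encode (flip_nth (Suc n) (list_decode m)) =
    (if m = 0 then 0 else Suc (prod_encode (fst (prod_decode (m - 1)),
        list_encode (flip_nth n (list_decode (snd (prod_decode (m - 1))))))))" for m
    by (subst list_decode_cases) auto
  then show ?case
    by (simp only:)
       (intro computable_intros computable_compose1[OF Suc]; simp)
qed

lemma length_flip_nth [simp]: "length (flip_nth n l) = length l"
  by (induction n l rule: flip_nth.induct) auto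

lemma nth_flip_nth: "k < length l \<Longrightarrow> flip_nth n l ! k =
   (if k = n then (if l ! k = 0 then 1 else if l ! k = 1 then 0 else l ! k) else l ! k)"
  by (induction n l arbitrary: k rule: flip_nth.induct) (auto simp: nth_Cons split: nat.split)

lemma flip_nth_flip_nth [simp]: "flip_nth n (flip_nth n l) = l"
  by (induction n l rule: flip_nth.induct) auto

definition flip_str :: "nat \<Rightarrow> bool list \<Rightarrow> bool list" where
  "flip_str n \<sigma> = map (\<lambda>k. if k = n then \<not> \<sigma> ! k else \<sigma> ! k) [0..<length \<sigma>]"

lemma flip_nth_of_bool: "flip_nth n (map of_bool \<sigma>) = map of_bool (flip_str n \<sigma>)"
  by (rule nth_equalityI) (auto simp: nth_flip_nth flip_str_def)

lemma vimage_flip_cyl: "flip n -` cyl \<sigma> = cyl (flip_str n \<sigma>)"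
proof -
  have nth: "flip n X k = \<sigma> ! k \<longleftrightarrow> X k = flip_str n \<sigma> ! k" if "k < length \<sigma>" for X k
    using that by (auto simp: flip_str_def)
  have len: "length (flip_str n \<sigma>) = length \<sigma>" by (simp add: flip_str_def)
  show ?thesis unfolding cyl_def vimage_def mem_Collect_eq len by (intro Collect_cong all_cong nth)
qed

lemma code_str_eq_iff: "code_str i \<sigma> = code_str j \<tau> \<longleftrightarrow> i = j \<and> \<sigma> = \<tau>"
proof -
  have "inj (of_bool :: bool \<Rightarrow> nat)" by (simp add: inj_def)
  then show ?thesis by (simp add: code_str_def prod_encode_eq list_encode_eq inj_map_eq_map)
qed

text \<open>The flip preserves measure, maps cylinders to cylinders of the same length, and acts on
  codes as a computable involution.\<close>

lemma ml_test_flip: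
  assumes V: "ml_test V"
  shows "ml_test (\<lambda>i. flip n -` V i)"
  unfolding ml_test_def
proof (intro conjI allI)
  fix i
  show "c_open (flip n -` V i)"
    unfolding c_open_def
  proof
    fix X assume "X \<in> flip n -` V i"
    then obtain \<sigma> where "flip n X \<in> cyl \<sigma>" "cyl \<sigma> \<subseteq> V i"
      using V unfolding ml_test_def c_open_def by blast
    then show "\<exists>\<sigma>. X \<in> cyl \<sigma> \<and> cyl \<sigma> \<subseteq> flip n -` V i"
      by (intro exI[of _ "flip_str n \<sigma>"]) (auto simp: vimage_flip_cyl[symmetric])
  qed
  show "emeasure lebC (flip n -` V i) \<le> ennreal ((1/2) ^ i)"
    using V by (simp add: emeasure_vimage_flip ml_test_def)
next
  let ?f = "\<lambda>m. prod_encode (fst (prod_decode m), list_encode (flip_nth n (list_decode (snd (prod_decode m)))))"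
  let ?A = "{code_str i \<sigma> |i \<sigma>. cyl \<sigma> \<subseteq> V i}"
  have ce: "ce ?A" using V by (simp add: ml_test_def)
  have sub: "cyl (flip_str n \<sigma>) \<subseteq> V i \<longleftrightarrow> cyl \<sigma> \<subseteq> flip n -` V i" for \<sigma> i
    unfolding vimage_flip_cyl[symmetric]
    using vimage_mono[of "cyl \<sigma>" "flip n -` V i" "flip n"] vimage_mono[of "flip n -` cyl \<sigma>" "V i" "flip n"]
    by auto
  have f_code: "?f (code_str i \<sigma>) = code_str i (flip_str n \<sigma>)" for i \<sigma>
    by (simp add: code_str_def flip_nth_of_bool)
  have ff: "?f (?f m) = m" for m by simp
  have flip2: "flip_str n (flip_str n \<sigma>) = \<sigma>" for \<sigma>
    by (rule nth_equalityI) (auto simp: flip_str_def)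
  have iff: "m \<in> {code_str i \<sigma> |i \<sigma>. cyl \<sigma> \<subseteq> flip n -` V i} \<longleftrightarrow> ?f m \<in> ?A" for m
  proof
    assume "m \<in> {code_str i \<sigma> |i \<sigma>. cyl \<sigma> \<subseteq> flip n -` V i}"
    then obtain i \<sigma> where "m = code_str i \<sigma>" "cyl \<sigma> \<subseteq> flip n -` V i" by blast
    then have "?f m = code_str i (flip_str n \<sigma>)" "cyl (flip_str n \<sigma>) \<subseteq> V i"
      using f_code sub by auto
    then show "?f m \<in> ?A" by blast
  next
    assume "?f m \<in> ?A"
    then obtain i \<sigma> where *: "?f m = code_str i \<sigma>" "cyl \<sigma> \<subseteq> V i" by blast
    then have "m = code_str i (flip_str n \<sigma>)" using ff[of m] f_code by simp
    moreover have "cyl (flip_str n \<sigma>) \<subseteq> flip n -` V i" using *(2) sub[of "flip_str n \<sigma>" i] flip2 by simp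
    ultimately show "m \<in> {code_str i \<sigma> |i \<sigma>. cyl \<sigma> \<subseteq> flip n -` V i}" by blast
  qed
  show "ce {code_str i \<sigma> |i \<sigma>. cyl \<sigma> \<subseteq> flip n -` V i}"
    by (rule ce_many_one[OF ce _ iff])
       (intro computable_intros computable_compose1[OF computable_flip_nth]; simp)
qed

lemma MLR_flip:
  assumes "X \<in> MLR" shows "flip n X \<in> MLR"
  using assms ml_test_flip[of _ n] unfolding MLR_def by fastforce

text \<open>The differing positions are flipped one at a time.\<close>

lemma MLR_finite_modification:
  assumes X: "X \<in> MLR" and fin: "finite {n. X n \<noteq> Y n}"
  shows "Y \<in> MLR"
proof -
  have "finite D \<Longrightarrow> {n. X n \<noteq> Y n} = D \<Longrightarrow> X \<in> MLR \<Longrightarrow> Y \<in> MLR" for D X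
  proof (induction D arbitrary: X rule: finite_induct)
    case empty
    then have "X = Y" by (simp add: fun_eq_iff)
    with empty show ?case by simp
  next
    case (insert n D)
    have "X n \<noteq> Y n" using insert.prems(1) by blast
    then have "{k. flip n X k \<noteq> Y k} = {k. X k \<noteq> Y k} - {n}" by (auto split: if_splits)
    also have "\<dots> = D" unfolding insert.prems(1) using insert.hyps(2) by simp
    finally show ?case by (rule insert.IH[OF _ MLR_flip[OF insert.prems(2)]])
  qed
  from this[OF fin refl X] show ?thesis .
qed

text \<open>Reads a code of \<open>(j, l)\<close> one entry at a time; \<open>0\<close> codes \<open>(0, [])\<close>, and is reached iff
  \<open>l\<close> is a binary string that starts with \<open>j\<close> zeros.\<close>

definition zeros_step :: "nat \<Rightarrow> nat" where
  "zeros_step m = (let j = fst (prod_decode m); l = snd (prod_decode m);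
      x = fst (prod_decode (l - 1)); l' = snd (prod_decode (l - 1)) in
    if l = 0 then m else if x = 0 then prod_encode (j - 1, l')
    else if x = 1 \<and> j = 0 then prod_encode (0, l') else m)"

lemma zeros_step_Nil: "zeros_step (prod_encode (j, list_encode [])) = prod_encode (j, list_encode [])"
  by (simp add: zeros_step_def)

lemma zeros_step_Cons: "zeros_step (prod_encode (j, list_encode (x # l))) =
   (if x = 0 then prod_encode (j - 1, list_encode l)
    else if x = 1 \<and> j = 0 then prod_encode (0, list_encode l) else prod_encode (j, list_encode (x # l)))"
  by (simp add: zeros_step_def Let_def)

text \<open>Rejected codes get stuck at a nonzero fixed point. Truncated subtraction in
  \<open>j - 1\<close> lets further zeros pass once the required ones have been read.\<close>

lemma zeros_step_iterate:
  "(\<exists>t. (zeros_step ^^ t) (prod_encode (j, list_encode l)) = 0) \<longleftrightarrow>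
    (\<exists>\<sigma>. l = map of_bool \<sigma> \<and> take j \<sigma> = replicate j False)"
proof (induction l arbitrary: j)
  case Nil
  have "(zeros_step ^^ t) (prod_encode (j, list_encode [])) = prod_encode (j, list_encode [])" for t
    by (induction t) (simp_all add: zeros_step_Nil del: list_encode.simps)
  moreover have "prod_encode (j, list_encode []) = 0 \<longleftrightarrow> j = 0"
    by (cases j) (simp_all add: prod_encode_def)
  ultimately show ?case by (cases j) auto
next
  case (Cons x l)
  let ?m = "prod_encode (j, list_encode (x # l))"
  have nz: "?m \<noteq> 0" by (simp add: prod_encode_def)
  have shift: "(\<exists>t. (zeros_step ^^ t) ?m = 0) \<longleftrightarrow> (\<exists>t. (zeros_step ^^ t) (zeros_step ?m) = 0)"
  proof
    assume "\<exists>t. (zeros_step ^^ t) ?m = 0"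
    then obtain t where t: "(zeros_step ^^ t) ?m = 0" by blast
    with nz obtain t' where "t = Suc t'" by (cases t) auto
    with t show "\<exists>t. (zeros_step ^^ t) (zeros_step ?m) = 0" by (auto simp: funpow_Suc_right simp del: funpow.simps)
  next
    assume "\<exists>t. (zeros_step ^^ t) (zeros_step ?m) = 0"
    then show "\<exists>t. (zeros_step ^^ t) ?m = 0" by (metis comp_apply funpow_Suc_right)
  qed
  consider "x = 0" | "x = 1" "j = 0" | "x \<noteq> 0" "x \<noteq> 1 \<or> j \<noteq> 0" by blast
  then show ?case
  proof cases
    case 1
    have "(\<exists>\<sigma>. x # l = map of_bool \<sigma> \<and> take j \<sigma> = replicate j False) \<longleftrightarrow>
       (\<exists>\<sigma>. l = map of_bool \<sigma> \<and> take (j - 1) \<sigma> = replicate (j - 1) False)" (is "?L \<longleftrightarrow> ?R")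
    proof
      assume ?L
      then show ?R using 1 by (cases j) (auto simp: Cons_eq_map_conv)
    next
      assume ?R
      then obtain \<sigma> where "l = map of_bool \<sigma>" "take (j - 1) \<sigma> = replicate (j - 1) False" by blast
      then show ?L using 1 by (intro exI[of _ "False # \<sigma>"]) (cases j; simp)
    qed
    then show ?thesis
      using 1 shift Cons.IH[of "j - 1"] by (simp add: zeros_step_Cons del: list_encode.simps)
  next
    case 2
    have "(\<exists>\<sigma>. x # l = map of_bool \<sigma>) \<longleftrightarrow> (\<exists>\<sigma>. l = map (of_bool :: bool \<Rightarrow> nat) \<sigma>)"
      using 2 by (auto simp: Cons_eq_map_conv intro: exI[of _ True])
    then show ?thesis
      using 2 shift Cons.IH[of 0] by (simp add: zeros_step_Cons del: list_encode.simps)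
  next
    case 3
    then have fp: "zeros_step ?m = ?m" by (auto simp: zeros_step_Cons simp del: list_encode.simps)
    have "(zeros_step ^^ t) ?m = ?m" for t by (induction t) (auto simp: fp simp del: list_encode.simps)
    moreover have "\<not> (\<exists>\<sigma>. x # l = map of_bool \<sigma> \<and> take j \<sigma> = replicate j False)"
      using 3 by (cases j) (auto simp: Cons_eq_map_conv)
    ultimately show ?thesis using nz by simp
  qed
qed

lemma computable_zeros_step: "computable n A \<Longrightarrow> computable n (\<lambda>p xs. zeros_step (A p xs))"
  by (rule computable_compose1[where F = "\<lambda>_. zeros_step"])
     (unfold zeros_step_def Let_def, (intro computable_intros; simp))

lemma ce_iterate:
  assumes f: "computable 1 (\<lambda>p xs. f (xs ! 0))"
  shows "ce {m. \<exists>t. (f ^^ t) m = 0}"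
proof -
  have *: "rec_nat m (\<lambda>_ y. f y) t = (f ^^ t) m" for t m by (induction t) auto
  have "computable (Suc 1) (\<lambda>p ys. rec_nat (ys ! 1) (\<lambda>_ y. f y) (ys ! 0))"
    by (intro computable_rec_nat computable_compose1[OF f]; intro computable_intros; simp)
  then have "computable (Suc 1) (\<lambda>p ys. (\<lambda>p t xs. (f ^^ t) (xs ! 0)) p (ys ! 0) (drop 1 ys))"
    by (rule computable_cong) (auto simp: *)
  then obtain e where e1: "\<And>p xs t. length xs = 1 \<Longrightarrow> (f ^^ t) (xs ! 0) = 0 \<Longrightarrow> ev p e xs (LEAST t. (f ^^ t) (xs ! 0) = 0)"
    and e2: "\<And>p xs y. length xs = 1 \<Longrightarrow> ev p e xs y \<Longrightarrow> (f ^^ y) (xs ! 0) = 0"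
    by (rule computable_LEAST) blast
  have "(\<exists>t. (f ^^ t) m = 0) \<longleftrightarrow> (\<exists>y. ev (\<lambda>_. 0) e [m] y)" for m
  proof
    assume "\<exists>t. (f ^^ t) m = 0"
    then obtain t where "(f ^^ t) m = 0" ..
    then show "\<exists>y. ev (\<lambda>_. 0) e [m] y" using e1[of "[m]" t] by auto
  next
    assume "\<exists>y. ev (\<lambda>_. 0) e [m] y"
    then obtain y where "ev (\<lambda>_. 0) e [m] y" ..
    then show "\<exists>t. (f ^^ t) m = 0" using e2[of "[m]"] by auto
  qed
  then show ?thesis unfolding ce_def by auto
qed

text \<open>The intersection of this test is the single zero sequence. It supplies a computable tail
  that makes any finite output nonrandom.\<close>

lemma ml_test_cyl_zeros: "ml_test (\<lambda>i. cyl (replicate i False))"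
  unfolding ml_test_def
proof (intro conjI allI)
  fix i
  show "c_open (cyl (replicate i False))"
    unfolding c_open_def by blast
  show "emeasure lebC (cyl (replicate i False)) \<le> ennreal ((1/2) ^ i)"
    by (simp add: emeasure_cyl_replicate)
next
  have "{code_str i \<sigma> |i \<sigma>. cyl \<sigma> \<subseteq> cyl (replicate i False)} = {m. \<exists>t. (zeros_step ^^ t) m = 0}"
  proof (rule set_eqI)
    fix m
    obtain j k where "prod_decode m = (j, k)" by (cases "prod_decode m")
    then have m: "m = prod_encode (j, list_encode (list_decode k))" by (metis list_decode_inverse prod_decode_inverse)
    show "m \<in> {code_str i \<sigma> |i \<sigma>. cyl \<sigma> \<subseteq> cyl (replicate i False)} \<longleftrightarrow> m \<in> {m. \<exists>t. (zeros_step ^^ t) m = 0}"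
      unfolding m mem_Collect_eq zeros_step_iterate cyl_subset_iff code_str_def
      by (auto simp: prod_encode_eq) (metis list_decode_inverse)
  qed
  moreover have "ce {m. \<exists>t. (zeros_step ^^ t) m = 0}"
    by (rule ce_iterate, rule computable_zeros_step, rule computable_nth) simp
  ultimately show "ce {code_str i \<sigma> |i \<sigma>. cyl \<sigma> \<subseteq> cyl (replicate i False)}"
    by (rule ssubst)
qed

lemma universal_eventually_zero:
  assumes U: "universal_ml_test U" and fin: "finite {n. X n}"
  shows "X \<in> U i"
proof -
  have "(\<lambda>_. False) \<in> (\<Inter>i. cyl (replicate i False))" by (simp add: cyl_def)
  then have "(\<lambda>_. False) \<notin> MLR" using ml_test_cyl_zeros unfolding MLR_def by blast
  then have "X \<notin> MLR" using MLR_finite_modification[of X "\<lambda>_. False"] fin by auto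
  then show ?thesis using U unfolding MLR_def universal_ml_test_def by blast
qed

section \<open>Guessing with finitely many changes\<close>

lemma mono_bounded_eventually_constant:
  fixes f :: "nat \<Rightarrow> nat"
  assumes "mono f" "\<And>t. f t \<le> B"
  obtains T where "\<And>t. t \<ge> T \<Longrightarrow> f t = f T"
proof -
  have "finite (range f)" using assms(2) by (intro finite_subset[of "range f" "{..B}"]) auto
  then have "Max (range f) \<in> range f" by simp
  then obtain T where T: "f T = Max (range f)" by auto
  show thesis
  proof (rule that[of T])
    fix t assume "t \<ge> T"
    then show "f t = f T"
      using monoD[OF assms(1), of T t] T Max_ge[OF \<open>finite (range f)\<close>, of "f t"] by simp
  qed
qed

text \<open>A state \<open>(\<sigma>, c, k, b)\<close> consists of the output \<open>\<sigma>\<close> so far, the current guess \<open>c\<close>, a level \<open>k\<close>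
  such that \<open>\<sigma>\<close> has been driven into all levels of the test below \<open>k\<close>, and a lower bound \<open>b\<close> on the
  level that the output has to reach; \<open>b\<close> exceeds the stage of the last change of the guess.\<close>

fun guess_step :: "(nat \<Rightarrow> bool list \<Rightarrow> nat \<Rightarrow> bool) \<Rightarrow> (nat \<Rightarrow> nat \<Rightarrow> bool) \<Rightarrow> (nat \<Rightarrow> nat \<Rightarrow> nat \<Rightarrow> nat) \<Rightarrow>
    nat \<Rightarrow> bool list \<times> nat \<times> nat \<times> nat \<Rightarrow> bool list \<times> nat \<times> nat \<times> nat" where
  "guess_step K R V t (\<sigma>, c, k, b) =
    (if k < b then if K k \<sigma> t then (\<sigma>, c, Suc k, b) else (\<sigma> @ [False], c, k, b)
     else if R c t then (\<sigma>, Suc c, k, Suc t)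
     else if V c t (length \<sigma>) = 0 then (\<sigma>, c, k, b)
     else (\<sigma> @ [V c t (length \<sigma>) = 2], c, k, b))"

primrec guess_run where
  "guess_run K R V 0 = ([], 0, 0, 0)"
| "guess_run K R V (Suc t) = guess_step K R V t (guess_run K R V t)"

text \<open>\<open>K k \<sigma> t\<close> is a confirmation at stage \<open>t\<close>,
  \<open>R c t\<close> a refutation, and \<open>V c t n\<close> is \<open>0\<close> for an unknown
  bit, \<open>1\<close> for false, \<open>2\<close> for true. A stage spent on zeros ignores
  refutations and values, so both must recur arbitrarily late. In \<open>level_reached\<close> one
  late stage must serve all \<open>m\<close> from \<open>N\<close> on, because the output gains a
  zero at every failing stage and is longer when that stage arrives. Values are constrained only for
  guesses that are never refuted.\<close>

locale guessing =
  fixes U :: "nat \<Rightarrow> (nat \<Rightarrow> bool) set"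
    and K :: "nat \<Rightarrow> bool list \<Rightarrow> nat \<Rightarrow> bool"
    and R :: "nat \<Rightarrow> nat \<Rightarrow> bool"
    and V :: "nat \<Rightarrow> nat \<Rightarrow> nat \<Rightarrow> nat"
  assumes level_sound: "K k \<sigma> t \<Longrightarrow> cyl \<sigma> \<subseteq> U k"
    and level_reached: "\<exists>N. \<forall>T. \<exists>t\<ge>T. \<forall>m\<ge>N. K k (\<sigma> @ replicate m False) t"
    and refuted_again: "R c t \<Longrightarrow> \<exists>t'\<ge>T. R c t'"
    and unrefuted_exists: "\<exists>c. \<forall>t. \<not> R c t"
    and unrefuted_value: "(\<And>t. \<not> R c t) \<Longrightarrow>
      \<exists>Y\<in>MLR. \<forall>n. (\<forall>t. V c t n \<in> {0, Suc (of_bool (Y n))}) \<and> (\<forall>T. \<exists>t\<ge>T. V c t n \<noteq> 0)"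
begin

section \<open>Invariants and limit of the run\<close>

definition "out t = fst (guess_run K R V t)"
definition "guess t = fst (snd (guess_run K R V t))"
definition "level t = fst (snd (snd (guess_run K R V t)))"
definition "bound t = snd (snd (snd (guess_run K R V t)))"

lemmas state_defs = out_def guess_def level_def bound_def

lemma state_0: "guess 0 = 0" "bound 0 = 0" "level 0 = 0" "out 0 = []"
  by (simp_all add: state_defs)

lemma state_Suc:
  "guess (Suc t) = (if \<not> level t < bound t \<and> R (guess t) t then Suc (guess t) else guess t)"
  "bound (Suc t) = (if \<not> level t < bound t \<and> R (guess t) t then Suc t else bound t)"
  "level (Suc t) = (if level t < bound t \<and> K (level t) (out t) t then Suc (level t) else level t)"
  "out (Suc t) = (if level t < bound t then if K (level t) (out t) t then out t else out t @ [False]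
     else if R (guess t) t \<or> V (guess t) t (length (out t)) = 0 then out t
     else out t @ [V (guess t) t (length (out t)) = 2])"
  by (cases "guess_run K R V t"; simp add: state_defs)+

lemma level_le_bound: "level t \<le> bound t \<and> bound t \<le> t"
  by (induction t) (auto simp: state_0 state_Suc)

lemma earlier_guess_refuted: "c < guess t \<Longrightarrow> \<exists>s. R c s"
  by (induction t) (auto simp: state_0 state_Suc less_Suc_eq split: if_splits)

lemma mono_guess: "mono guess" and mono_level: "mono level"
  by (auto simp: mono_iff_le_Suc state_Suc)

text \<open>A change at stage \<open>t\<close> resets the bound to \<open>Suc t\<close>, the index
  of the first state with the new guess.\<close>

lemma guess_since_bound: "bound t \<le> s \<Longrightarrow> s \<le> t \<Longrightarrow> guess s = guess t"
  by (induction t) (auto simp: state_Suc le_Suc_eq split: if_splits)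

lemma out_extends: "s \<le> t \<Longrightarrow> \<exists>\<tau>. out t = out s @ \<tau>"
proof (induction t)
  case (Suc t)
  then show ?case by (cases "s = Suc t") (auto simp: state_Suc le_Suc_eq)
qed (simp add: state_0)

lemma out_nth: "s \<le> t \<Longrightarrow> n < length (out s) \<Longrightarrow> out t ! n = out s ! n"
  using out_extends[of s t] by (auto simp: nth_append)

lemma length_out_mono: "s \<le> t \<Longrightarrow> length (out s) \<le> length (out t)"
  using out_extends[of s t] by auto

lemma out_in_levels: "j < level t \<Longrightarrow> cyl (out t) \<subseteq> U j"
proof (induction t)
  case (Suc t)
  have "cyl (out (Suc t)) \<subseteq> cyl (out t)"
    using out_extends[of t "Suc t"] by (auto simp: cyl_subset_iff)
  moreover have "cyl (out t) \<subseteq> U j"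
    using Suc level_sound[of "level t" "out t" t] by (auto simp: state_Suc less_Suc_eq split: if_splits)
  ultimately show ?case by blast
qed (simp add: state_0)

text \<open>Guesses advance by one and only past refuted ones, so an unrefuted guess caps them. Once
  the guess is constant, so is the bound, which in turn caps the level; a level stuck below the
  bound would mean zeros forever.\<close>

lemma stabilizes:
  obtains T where "\<And>t. t \<ge> T \<Longrightarrow> guess t = guess T" "\<And>t. t \<ge> T \<Longrightarrow> bound t = bound T"
    "level T = bound T" "\<And>t. t \<ge> T \<Longrightarrow> level t = level T" "\<And>t. \<not> R (guess T) t"
proof -
  obtain c where c: "\<And>t. \<not> R c t" using unrefuted_exists by blast
  have "guess t \<le> c" for t using earlier_guess_refuted[of c t] c by (auto simp: not_less[symmetric])
  then obtain T1 where T1: "\<And>t. t \<ge> T1 \<Longrightarrow> guess t = guess T1"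
    using mono_bounded_eventually_constant[OF mono_guess] by metis
  have bound: "bound t = bound T1" if "t \<ge> T1" for t
    using that
  proof (induction rule: dec_induct)
    case (step t)
    then show ?case using T1[of t] T1[of "Suc t"] by (auto simp: state_Suc split: if_splits)
  qed simp
  have "level t \<le> bound T1" for t
    using level_le_bound[of "max t T1"] bound[of "max t T1"] monoD[OF mono_level, of t "max t T1"] by simp
  then obtain T2 where T2: "\<And>t. t \<ge> T2 \<Longrightarrow> level t = level T2"
    using mono_bounded_eventually_constant[OF mono_level] by metis
  define T where "T = max T1 T2"
  have T: "guess t = guess T" "bound t = bound T" "level t = level T" if "t \<ge> T" for t
    using that T1[of t] T1[of T] bound[of t] bound[of T] T2[of t] T2[of T] by (auto simp: T_def)
  have level: "level T = bound T"
  proof (rule ccontr)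
    assume "level T \<noteq> bound T"
    then have less: "level t < bound t" if "t \<ge> T" for t
      using level_le_bound[of T] T[OF that] by simp
    have nK: "\<not> K (level T) (out t) t" if "t \<ge> T" for t
      using T(3)[of t] T(3)[of "Suc t"] less[OF that] that by (auto simp: state_Suc split: if_splits)
    have out: "out t = out T @ replicate (t - T) False" if "t \<ge> T" for t
      using that
    proof (induction rule: dec_induct)
      case (step t)
      then have "out (Suc t) = out t @ [False]"
        using less[of t] nK[of t] T(3)[of t] by (simp add: state_Suc)
      with step show ?case by (simp add: Suc_diff_le replicate_append_same)
    qed simp
    obtain N where N: "\<And>t0. \<exists>t\<ge>t0. \<forall>m\<ge>N. K (level T) (out T @ replicate m False) t"
      using level_reached[of "level T" "out T"] by blast
    \<comment> \<open>From stage \<open>T + N\<close> on at least \<open>N\<close> zeros have been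
      appended, and the confirmation tolerates any larger number.\<close>
    obtain t where "t \<ge> T + N" "\<forall>m\<ge>N. K (level T) (out T @ replicate m False) t"
      using N[of "T + N"] by blast
    then show False using nK[of t] out[of t] by auto
  qed
  have "\<not> R (guess T) t" for t
  proof
    assume "R (guess T) t"
    \<comment> \<open>The given refutation may fall in a phase of appending zeros, where it has no
      effect; a later copy does.\<close>
    then obtain t' where "t' \<ge> T" "R (guess T) t'" using refuted_again by blast
    then show False using T[of t'] T(1)[of "Suc t'"] level by (simp add: state_Suc)
  qed
  then show thesis using that[of T] T level by blast
qed

lemma limit_output:
  "\<exists>Z\<in>MLR. (\<forall>t. \<forall>n<length (out t). out t ! n = Z n) \<and> (\<forall>n. \<exists>t. n < length (out t)) \<and>
    (\<forall>z. Z \<notin> U z \<longrightarrow> (\<forall>t. \<not> R (guess z) t))"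
proof -
  obtain T where T: "\<And>t. t \<ge> T \<Longrightarrow> guess t = guess T" "\<And>t. t \<ge> T \<Longrightarrow> bound t = bound T"
    "level T = bound T" "\<And>t. t \<ge> T \<Longrightarrow> level t = level T" "\<And>t. \<not> R (guess T) t"
    using stabilizes by blast
  obtain Y where Y: "Y \<in> MLR" "\<And>t n. V (guess T) t n \<in> {0, Suc (of_bool (Y n))}"
    "\<And>t0 n. \<exists>t\<ge>t0. V (guess T) t n \<noteq> 0"
    using unrefuted_value[OF T(5)] by blast
  \<comment> \<open>\<open>V\<close> is queried at position \<open>length (out t)\<close>: positions
    taken by earlier guesses or by padding are skipped instead of shifting \<open>Y\<close>, which
    keeps the limit a finite modification of \<open>Y\<close>.\<close>
  have out_Suc: "out (Suc t) = (if V (guess T) t (length (out t)) = 0 then out t else out t @ [Y (length (out t))])"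
    if "t \<ge> T" for t
    using T(1,2,4)[OF that] T(3,5) Y(2)[of t "length (out t)"]
    by (cases "Y (length (out t))") (auto simp: state_Suc)
  have unbounded: "\<exists>t. n \<le> length (out t)" for n
  proof (induction n)
    case (Suc n)
    then obtain t where "n \<le> length (out t)" by blast
    obtain t' where t': "t' \<ge> max t T" "V (guess T) t' n \<noteq> 0" using Y(3) by blast
    have "n \<le> length (out t')"
      using \<open>n \<le> _\<close> length_out_mono[of t t'] t'(1) by simp
    then have "Suc n \<le> length (out (Suc t'))"
      using out_Suc[of t'] t' by (cases "length (out t') = n") auto
    then show ?case by blast
  qed auto
  define Z where "Z n = out (LEAST t. n < length (out t)) ! n" for n
  have Z: "out t ! n = Z n" if "n < length (out t)" for t n
    unfolding Z_def
    by (rule out_nth) (auto intro: Least_le LeastI[of "\<lambda>t. n < length (out t)"] that)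
  have Z_cyl: "Z \<in> cyl (out t)" for t using Z by (simp add: cyl_def)
  have "out t ! n = Y n" if "T \<le> t" "length (out T) \<le> n" "n < length (out t)" for t n
    using that
  proof (induction t arbitrary: n rule: dec_induct)
    case (step t)
    then show ?case using out_Suc[of t] by (auto simp: nth_append less_Suc_eq split: if_splits)
  qed simp
  then have "Y n = Z n" if "length (out T) \<le> n" for n
    using unbounded[of "Suc n"] length_out_mono[of _ T] Z that
    by (metis Suc_le_lessD leD le_cases order_less_le_trans)
  then have "{n. Y n \<noteq> Z n} \<subseteq> {..<length (out T)}" by (auto simp: not_le[symmetric])
  then have "Z \<in> MLR" using MLR_finite_modification[OF Y(1)] finite_subset by blast
  moreover have "\<not> R (guess z) t" if "Z \<notin> U z" for z t
  proof -
    \<comment> \<open>All levels below the final one contain \<open>Z\<close>, and the final level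
      equals the final bound; an avoided level is thus at or beyond the bound.\<close>
    have "\<not> z < level T" using out_in_levels[of z T] Z_cyl[of T] that by blast
    then have "bound (max z T) \<le> z" using T(2)[of "max z T"] T(3) by simp
    then have "guess z = guess (max z T)" by (rule guess_since_bound) simp
    then show ?thesis using T(1)[of "max z T"] T(5) by simp
  qed
  ultimately show ?thesis using Z unbounded by (metis Suc_le_lessD)
qed

end

section \<open>Reductions to layers\<close>

text \<open>"Eventually" instead of "at some stage" ensures that finitely many values are known at a
  common stage, so that approximations can be composed.\<close>

definition approximates :: "(nat \<Rightarrow> nat \<Rightarrow> nat) \<Rightarrow> (nat \<Rightarrow> nat) \<Rightarrow> bool" where
  "approximates G f \<longleftrightarrow>
     (\<forall>s n v. G s n = Suc v \<longrightarrow> f n = v) \<and> (\<forall>n. \<forall>\<^sub>F s in sequentially. G s n = Suc (f n))"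

lemma approximates_Suc: "approximates (\<lambda>s n. Suc (f n)) f"
  by (simp add: approximates_def)

lemma approximates_value: "approximates G f \<Longrightarrow> G s n \<in> {0, Suc (f n)}"
  unfolding approximates_def by (metis insertCI not0_implies_Suc)

lemma approximates_bpair:
  "approximates G f \<Longrightarrow> approximates H g \<Longrightarrow> approximates (\<lambda>s. bpair (G s) (H s)) (bpair f g)"
  unfolding approximates_def bpair_def by auto

lemma approximates_approx:
  assumes G: "approximates G f" and g: "tf e f = Some g"
  shows "approximates (\<lambda>s n. approx (G s) s e [n]) g"
  unfolding approximates_def
proof (intro conjI allI impI)
  fix s n v assume "approx (G s) s e [n] = Suc v"
  then have "ev f e [n] v"
    using G by (intro approx_sound[of "G s"]) (auto simp: approximates_def)
  with g show "g n = v" unfolding tf_eq_Some_iff using ev_deterministic by blast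
next
  fix n
  show "\<forall>\<^sub>F s in sequentially. approx (G s) s e [n] = Suc (g n)"
    using G g by (intro approx_complete) (auto simp: approximates_def tf_eq_Some_iff)
qed

text \<open>The oracle \<open>\<lambda>_. 1\<close> is the fully known zero oracle, the one that
  \<open>ce\<close> uses. The guard on \<open>G\<close> matters because \<open>0 - 1 = 0\<close>
  would read an unknown bit as false.\<close>

definition seen_in :: "rf \<Rightarrow> (nat \<Rightarrow> nat) \<Rightarrow> nat \<Rightarrow> nat \<Rightarrow> nat \<Rightarrow> bool" where
  "seen_in a G i n s \<longleftrightarrow> (\<forall>m<n. G m \<noteq> 0) \<and>
     approx (\<lambda>_. 1) s a [prod_encode (i, list_encode (map (\<lambda>m. G m - 1) [0..<n]))] \<noteq> 0"

text \<open>List codes grow at the head, so the primitive recursion runs through the indices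
  downwards.\<close>

lemma list_encode_map_upt:
  "list_encode (map g [0..<n]) = rec_nat 0 (\<lambda>m y. Suc (prod_encode (g (n - 1 - m), y))) n"
proof -
  have "j \<le> n \<Longrightarrow> list_encode (map g [n - j..<n]) =
      rec_nat 0 (\<lambda>m y. Suc (prod_encode (g (n - 1 - m), y))) j" for j
  proof (induction j)
    case (Suc j)
    then have "[n - Suc j..<n] = (n - Suc j) # [n - j..<n]"
      by (subst upt_conv_Cons) (auto simp: Suc_diff_Suc)
    with Suc show ?case by simp
  qed simp
  from this[of n] show ?thesis by simp
qed

lemma decidable_seen_in:
  assumes G: "computable (Suc q) (\<lambda>p ys. G p (ys ! 0) (drop 1 ys))"
    and I: "computable q I" and N: "computable q N" and S: "computable q S"
  shows "decidable q (\<lambda>p xs. seen_in a (\<lambda>m. G p m xs) (I p xs) (N p xs) (S p xs))"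
proof -
  have "computable (2 + q) (\<lambda>p xs. G p (N p (drop 2 xs) - 1 - xs ! 0) (drop 2 xs))"
    by (intro computable_compose_drop[OF G] computable_intros computable_drop[OF N]) simp_all
  then have "computable q (\<lambda>p xs. list_encode (map (\<lambda>m. G p m xs - 1) [0..<N p xs]))"
    unfolding list_encode_map_upt
    by (intro computable_rec_nat computable_intros N) simp_all
  then show ?thesis
    unfolding seen_in_def
    by (intro decidable_conj decidable_not decidable_eq_zero decidable_all_less computable_approx
        computable_prod_encode I N S G computable_const)
qed

lemma seen_in_prefix_iff:
  assumes "\<And>m. m < n \<Longrightarrow> G m = Suc (of_bool (X m))"
  shows "seen_in a G i n s \<longleftrightarrow> approx (\<lambda>_. 1) s a [code_str i (map X [0..<n])] \<noteq> 0"
proof -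
  have eq: "map (\<lambda>m. G m - 1) [0..<n] = map of_bool (map X [0..<n])" using assms by simp
  show ?thesis unfolding seen_in_def code_str_def eq using assms by simp
qed

definition enumerates :: "rf \<Rightarrow> (nat \<Rightarrow> (nat \<Rightarrow> bool) set) \<Rightarrow> bool" where
  "enumerates a U \<longleftrightarrow> (\<forall>i \<sigma>. cyl \<sigma> \<subseteq> U i \<longleftrightarrow> (\<exists>y. ev (\<lambda>_. 0) a [code_str i \<sigma>] y))"

lemma ml_test_enumerates:
  assumes "ml_test U" obtains a where "enumerates a U"
proof -
  have code: "code_str i \<sigma> \<in> {code_str i \<sigma> |i \<sigma>. cyl \<sigma> \<subseteq> U i} \<longleftrightarrow> cyl \<sigma> \<subseteq> U i" for i \<sigma>
    by (auto simp: code_str_eq_iff)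
  obtain a where a: "\<And>n. n \<in> {code_str i \<sigma> |i \<sigma>. cyl \<sigma> \<subseteq> U i} \<longleftrightarrow> (\<exists>y. ev (\<lambda>_. 0) a [n] y)"
    using assms unfolding ml_test_def ce_def by blast
  have "enumerates a U" unfolding enumerates_def a[symmetric] code by simp
  then show thesis by (rule that)
qed

lemma approx_enumerates_sound:
  assumes "enumerates a U" "approx (\<lambda>_. 1) s a [code_str i \<sigma>] \<noteq> 0"
  shows "cyl \<sigma> \<subseteq> U i"
proof -
  obtain y where "approx (\<lambda>_. 1) s a [code_str i \<sigma>] = Suc y" using assms(2) not0_implies_Suc by blast
  then have "ev (\<lambda>_. 0) a [code_str i \<sigma>] y" by (rule approx_sound[rotated]) simp
  with assms(1) show ?thesis unfolding enumerates_def by blast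
qed

lemma approx_enumerates_complete:
  assumes "enumerates a U" "cyl \<sigma> \<subseteq> U i"
  shows "\<forall>\<^sub>F s in sequentially. approx (\<lambda>_. 1) s a [code_str i \<sigma>] \<noteq> 0"
proof -
  obtain y where "ev (\<lambda>_. 0) a [code_str i \<sigma>] y" using assms unfolding enumerates_def by blast
  then have "\<forall>\<^sub>F s in sequentially. approx (\<lambda>_. 1) s a [code_str i \<sigma>] = Suc y"
    by (intro approx_complete) simp_all
  then show ?thesis by (rule eventually_mono) simp
qed

lemma seen_in_sound:
  assumes "enumerates a U" "approximates G (\<lambda>n. of_bool (X n))" "seen_in a (G s) i n s'"
  shows "X \<in> U i"
proof -
  have "G s m = Suc (of_bool (X m))" if "m < n" for m
    using assms(3) that approximates_value[OF assms(2), of s m] by (auto simp: seen_in_def)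
  with assms(3) have "approx (\<lambda>_. 1) s' a [code_str i (map X [0..<n])] \<noteq> 0"
    by (simp add: seen_in_prefix_iff[of n "G s" X])
  with assms(1) have "cyl (map X [0..<n]) \<subseteq> U i" by (rule approx_enumerates_sound)
  then show ?thesis using cyl_take by blast
qed

lemma c_open_prefix:
  assumes "c_open V" "X \<in> V" obtains n where "cyl (map X [0..<n]) \<subseteq> V"
proof -
  obtain \<sigma> where "X \<in> cyl \<sigma>" "cyl \<sigma> \<subseteq> V" using assms unfolding c_open_def by blast
  moreover from \<open>X \<in> cyl \<sigma>\<close> have "map X [0..<length \<sigma>] = \<sigma>"
    by (intro nth_equalityI) (auto simp: cyl_def)
  ultimately show thesis using that[of "length \<sigma>"] by simp
qed

text \<open>Openness provides a prefix whose cylinder already lies in the level; its finitely many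
  bits and its enumeration are all present at one late stage.\<close>

lemma seen_in_complete:
  assumes a: "enumerates a U" and "c_open (U i)" and G: "approximates G (\<lambda>n. of_bool (X n))" and "X \<in> U i"
  shows "\<exists>n s. seen_in a (G s) i n s"
proof -
  obtain n where n: "cyl (map X [0..<n]) \<subseteq> U i" using assms(2,4) by (rule c_open_prefix)
  have "\<forall>\<^sub>F s in sequentially. \<forall>m\<in>{..<n}. G s m = Suc (of_bool (X m))"
    using G by (intro eventually_ball_finite) (auto simp: approximates_def)
  with approx_enumerates_complete[OF a n] have "\<forall>\<^sub>F s in sequentially. seen_in a (G s) i n s"
    by eventually_elim (subst seen_in_prefix_iff[where X = X]; simp)
  from eventually_happens'[OF sequentially_bot this] show ?thesis by blast
qed

text \<open>Halving satisfies \<open>Suc k div 2 = k - k div 2\<close>, a primitive recursion that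
  uses only subtraction.\<close>

lemma computable_div2: "computable n A \<Longrightarrow> computable n (\<lambda>p xs. A p xs div 2)"
proof -
  have *: "rec_nat 0 (\<lambda>m y. m - y) k = k div 2" for k :: nat
  proof (induction k)
    case (Suc k)
    then have "rec_nat 0 (\<lambda>m y. m - y) (Suc k) = k - k div 2" by simp
    also have "\<dots> = Suc k div 2" by presburger
    finally show ?case .
  qed simp
  assume "computable n A"
  then have "computable n (\<lambda>p xs. rec_nat 0 (\<lambda>m y. m - y) (A p xs))"
    by (intro computable_rec_nat computable_intros) simp_all
  then show ?thesis by (simp only: *)
qed

lemma decidable_even: "computable n A \<Longrightarrow> decidable n (\<lambda>p xs. even (A p xs))"
proof -
  have *: "even k \<longleftrightarrow> 2 * (k div 2) = k" for k :: nat by presburger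
  assume "computable n A"
  then show ?thesis unfolding * by (intro computable_intros computable_div2)
qed

lemma computable_bpair:
  assumes "computable (Suc n) (\<lambda>p ys. F p (ys ! 0) (drop 1 ys))"
    "computable (Suc n) (\<lambda>p ys. G p (ys ! 0) (drop 1 ys))" "computable n A"
  shows "computable n (\<lambda>p xs. bpair (\<lambda>m. F p m xs) (\<lambda>m. G p m xs) (A p xs))"
proof -
  have "computable n (\<lambda>p xs. F p (A p xs div 2) xs)" "computable n (\<lambda>p xs. G p (A p xs div 2) xs)"
    using computable_compose_drop[of n F 0] computable_compose_drop[of n G 0] assms computable_div2
    by simp_all
  then show ?thesis
    unfolding bpair_def by (intro computable_if decidable_even assms)
qed

definition nat_name :: "nat \<Rightarrow> nat \<Rightarrow> nat" where
  "nat_name i k = (if k = i then 1 else 0)"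

lemma delta_nat_eq_Some_iff: "delta_nat q = Some i \<longleftrightarrow> q = nat_name i"
proof -
  have "nat_name i = nat_name j \<longleftrightarrow> i = j" for i j
    by (auto simp: nat_name_def fun_eq_iff split: if_splits)
  moreover have "(\<lambda>k. if k = n then 1 else 0) = nat_name n" for n
    by (simp add: nat_name_def fun_eq_iff)
  ultimately show ?thesis unfolding delta_nat_def by auto
qed

lemma delta_MLR_eq_Some_iff: "delta_MLR p = Some X \<longleftrightarrow> p = (\<lambda>n. of_bool (X n)) \<and> X \<in> MLR"
proof -
  have "p = (\<lambda>n. of_bool (p n = 1))" if "\<And>n. p n \<le> 1"
  proof
    fix n
    have "p n = 0 \<or> p n = 1" using that[of n] by auto
    then show "p n = of_bool (p n = 1)" by auto
  qed
  moreover have "of_bool b \<le> (1 :: nat)" "of_bool b = (1 :: nat) \<longleftrightarrow> b" for b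
    by (cases b; simp)+
  ultimately show ?thesis unfolding delta_MLR_def by auto
qed

text \<open>Eliminates the quantifier over realizers. A realizer may answer \<open>X\<close> by any
  level that avoids it, so the decoder has to succeed for each of them.\<close>

lemma W_le_LAY_iff:
  assumes "ml_test U"
  shows "W_le \<delta>X \<delta>Y f delta_MLR delta_nat (LAY U) \<longleftrightarrow>
    (\<exists>\<Phi> \<Psi>. \<forall>p x. \<delta>X p = Some x \<longrightarrow> f x \<noteq> {} \<longrightarrow>
       (\<exists>X\<in>MLR. tf \<Phi> p = Some (\<lambda>n. of_bool (X n)) \<and>
         (\<forall>i. X \<notin> U i \<longrightarrow> (\<exists>q y. tf \<Psi> (bpair p (nat_name i)) = Some q \<and> \<delta>Y q = Some y \<and> y \<in> f x))))"
    (is "_ \<longleftrightarrow> (\<exists>\<Phi> \<Psi>. ?P \<Phi> \<Psi>)")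
proof -
  have LAY: "X \<in> MLR \<Longrightarrow> LAY U X \<noteq> {}" for X
    using assms unfolding MLR_def LAY_def by auto
  have "(\<forall>\<Gamma>. realizes delta_MLR delta_nat (LAY U) \<Gamma> \<longrightarrow> realizes \<delta>X \<delta>Y f
      (\<lambda>p. Option.bind (tf \<Phi> p) (\<lambda>r. Option.bind (\<Gamma> r) (\<lambda>q. tf \<Psi> (bpair p q))))) \<longleftrightarrow> ?P \<Phi> \<Psi>"
    (is "?L \<longleftrightarrow> _") for \<Phi> \<Psi>
  proof
    assume L: ?L
    show "?P \<Phi> \<Psi>"
    proof (intro allI impI)
      fix p x assume px: "\<delta>X p = Some x" "f x \<noteq> {}"
      \<comment> \<open>A realizer whose answer depends on the instance alone, through an arbitrary
        choice \<open>sel\<close> of levels.\<close>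
      define \<Gamma> where "\<Gamma> sel r = (case delta_MLR r of None \<Rightarrow> None | Some X \<Rightarrow> Some (nat_name (sel X)))"
        for sel :: "(nat \<Rightarrow> bool) \<Rightarrow> nat" and r
      have sel: "\<exists>X q y. tf \<Phi> p = Some (\<lambda>n. of_bool (X n)) \<and> X \<in> MLR \<and>
          tf \<Psi> (bpair p (nat_name (sel X))) = Some q \<and> \<delta>Y q = Some y \<and> y \<in> f x"
        if "\<And>X. X \<in> MLR \<Longrightarrow> sel X \<in> LAY U X" for sel
      proof -
        have "realizes delta_MLR delta_nat (LAY U) (\<Gamma> sel)"
          unfolding realizes_def \<Gamma>_def using that by (auto simp: delta_nat_eq_Some_iff LAY_def split: if_splits)
        with L have "realizes \<delta>X \<delta>Y f
          (\<lambda>p. Option.bind (tf \<Phi> p) (\<lambda>r. Option.bind (\<Gamma> sel r) (\<lambda>q. tf \<Psi> (bpair p q))))" by blast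
        with px obtain q y where "Option.bind (tf \<Phi> p) (\<lambda>r. Option.bind (\<Gamma> sel r) (\<lambda>q. tf \<Psi> (bpair p q))) = Some q"
          "\<delta>Y q = Some y" "y \<in> f x"
          unfolding realizes_def by blast
        then show ?thesis
          unfolding \<Gamma>_def by (auto simp: bind_eq_Some_conv delta_MLR_eq_Some_iff split: option.splits)
      qed
      obtain X where X: "tf \<Phi> p = Some (\<lambda>n. of_bool (X n))" "X \<in> MLR"
        using sel[of "\<lambda>X. SOME i. i \<in> LAY U X"] LAY by (auto simp: some_in_eq)
      have "\<exists>q y. tf \<Psi> (bpair p (nat_name i)) = Some q \<and> \<delta>Y q = Some y \<and> y \<in> f x" if "X \<notin> U i" for i
      proof -
        have "X' = X" if "tf \<Phi> p = Some (\<lambda>n. of_bool (X' n))" for X'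
          using that X(1) by (simp add: fun_eq_iff of_bool_eq_iff)
        \<comment> \<open>Prescribing the answer \<open>i\<close> at the one instance
          \<open>X\<close>, and any admissible answer elsewhere, is again a legal choice.\<close>
        moreover have "(if X' = X then i else SOME i. i \<in> LAY U X') \<in> LAY U X'" if "X' \<in> MLR" for X'
          using LAY[OF that] X(2) \<open>X \<notin> U i\<close> by (cases "X' = X") (simp_all add: some_in_eq, simp add: LAY_def)
        ultimately show ?thesis
          using sel[of "\<lambda>X'. if X' = X then i else SOME i. i \<in> LAY U X'"] by fastforce
      qed
      with X show "\<exists>X\<in>MLR. tf \<Phi> p = Some (\<lambda>n. of_bool (X n)) \<and>
         (\<forall>i. X \<notin> U i \<longrightarrow> (\<exists>q y. tf \<Psi> (bpair p (nat_name i)) = Some q \<and> \<delta>Y q = Some y \<and> y \<in> f x))"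
        by blast
    qed
  next
    assume P: "?P \<Phi> \<Psi>"
    show ?L
    proof (intro allI impI)
      fix \<Gamma> assume \<Gamma>: "realizes delta_MLR delta_nat (LAY U) \<Gamma>"
      show "realizes \<delta>X \<delta>Y f
         (\<lambda>p. Option.bind (tf \<Phi> p) (\<lambda>r. Option.bind (\<Gamma> r) (\<lambda>q. tf \<Psi> (bpair p q))))"
        unfolding realizes_def
      proof (intro allI impI)
        fix p x assume "\<delta>X p = Some x" "f x \<noteq> {}"
        with P obtain X where X: "X \<in> MLR" "tf \<Phi> p = Some (\<lambda>n. of_bool (X n))"
          "\<And>i. X \<notin> U i \<Longrightarrow> \<exists>q y. tf \<Psi> (bpair p (nat_name i)) = Some q \<and> \<delta>Y q = Some y \<and> y \<in> f x"
          by blast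
        have "delta_MLR (\<lambda>n. of_bool (X n)) = Some X" using X(1) by (simp add: delta_MLR_eq_Some_iff)
        with \<Gamma> LAY[OF X(1)] obtain q i where "\<Gamma> (\<lambda>n. of_bool (X n)) = Some q" "delta_nat q = Some i" "i \<in> LAY U X"
          unfolding realizes_def by blast
        then show "\<exists>q y. Option.bind (tf \<Phi> p) (\<lambda>r. Option.bind (\<Gamma> r) (\<lambda>q. tf \<Psi> (bpair p q))) = Some q
            \<and> \<delta>Y q = Some y \<and> y \<in> f x"
          using X by (auto simp: delta_nat_eq_Some_iff LAY_def)
      qed
    qed
  qed
  then show ?thesis unfolding W_le_def by simp
qed

section \<open>Composition of two reductions\<close>

definition code_nth :: "nat \<Rightarrow> nat \<Rightarrow> nat" where
  "code_nth l j = fst (prod_decode (((\<lambda>l. snd (prod_decode (l - 1))) ^^ j) l - 1))"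

lemma code_nth_list_encode: "j < length l \<Longrightarrow> code_nth (list_encode l) j = l ! j"
proof -
  \<comment> \<open>Needed for the empty list: its code \<open>0\<close> is truncated at
    \<open>0 - 1\<close> and decodes to \<open>(0, 0)\<close>, so the tail of the empty code is
    empty.\<close>
  have "prod_encode (0, 0) = 0" by (simp add: prod_encode_def)
  then have "prod_decode 0 = (0, 0)" by (metis prod_encode_inverse)
  then have tl: "snd (prod_decode (list_encode l - 1)) = list_encode (tl l)" for l
    by (cases l) simp_all
  have "((\<lambda>l. snd (prod_decode (l - 1))) ^^ j) (list_encode l) = list_encode (drop j l)" for j
  proof (induction j)
    case (Suc j)
    then show ?case by (simp only: funpow.simps comp_apply tl) (simp add: drop_Suc tl_drop)
  qed simp
  moreover assume "j < length l"
  ultimately show ?thesis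
    by (simp add: code_nth_def Cons_nth_drop_Suc[symmetric])
qed

lemma computable_code_nth:
  assumes "computable n A" "computable n B"
  shows "computable n (\<lambda>p xs. code_nth (A p xs) (B p xs))"
proof -
  have *: "(f ^^ j) l = rec_nat l (\<lambda>_ y. f y) j" for f j and l :: nat
    by (induction j) auto
  show ?thesis unfolding code_nth_def *
    by (intro computable_intros computable_rec_nat assms) simp_all
qed

text \<open>A stage codes a prefix length, a step bound and a third number that is discarded, so
  that every pair of the first two occurs arbitrarily late.\<close>

definition stage_length :: "nat \<Rightarrow> nat" where
  "stage_length t = fst (prod_decode (fst (prod_decode t)))"

definition stage_steps :: "nat \<Rightarrow> nat" where
  "stage_steps t = snd (prod_decode (fst (prod_decode t)))"

lemma stage_exists: "\<exists>t\<ge>T. stage_length t = n \<and> stage_steps t = s"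
  by (rule exI[of _ "prod_encode (prod_encode (n, s), T)"])
     (simp add: stage_length_def stage_steps_def le_prod_encode_2)

lemma computable_stage_length: "computable n A \<Longrightarrow> computable n (\<lambda>p xs. stage_length (A p xs))"
  and computable_stage_steps: "computable n A \<Longrightarrow> computable n (\<lambda>p xs. stage_steps (A p xs))"
  unfolding stage_length_def stage_steps_def by (intro computable_intros; assumption)+

definition known :: "bool list \<Rightarrow> nat \<Rightarrow> nat" where
  "known \<sigma> m = (if m < length \<sigma> then Suc (of_bool (\<sigma> ! m)) else 0)"

definition driven :: "rf \<Rightarrow> nat \<Rightarrow> bool list \<Rightarrow> nat \<Rightarrow> bool" where
  "driven a k \<sigma> t \<longleftrightarrow> seen_in a (known \<sigma>) k (stage_length t) (stage_steps t)"

lemma driven_sound: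
  assumes "enumerates a U" "driven a k \<sigma> t" shows "cyl \<sigma> \<subseteq> U k"
proof -
  let ?n = "stage_length t"
  have known: "known \<sigma> m \<noteq> 0" if "m < ?n" for m
    using assms(2) that by (simp add: driven_def seen_in_def)
  have le: "?n \<le> length \<sigma>"
    using known[of "length \<sigma>"] by (cases "length \<sigma> < ?n") (simp_all add: known_def)
  have "seen_in a (known \<sigma>) k ?n (stage_steps t) \<longleftrightarrow>
      approx (\<lambda>_. 1) (stage_steps t) a [code_str k (map (nth \<sigma>) [0..<?n])] \<noteq> 0"
    using le by (intro seen_in_prefix_iff) (simp add: known_def)
  with assms have "cyl (map (nth \<sigma>) [0..<?n]) \<subseteq> U k"
    by (intro approx_enumerates_sound[OF assms(1)]) (simp add: driven_def)
  moreover have "cyl \<sigma> \<subseteq> cyl (map (nth \<sigma>) [0..<?n])"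
    using le by (auto simp: cyl_def)
  ultimately show ?thesis by blast
qed

text \<open>\<open>N\<close> is the length of a prefix of \<open>\<sigma>\<close> followed by zeros
  whose cylinder lies in level \<open>k\<close>. With \<open>N\<close> zeros appended, this prefix
  is known whatever the number of further zeros.\<close>

lemma driven_reached:
  assumes a: "enumerates a U" and U: "universal_ml_test U"
  shows "\<exists>N. \<forall>T. \<exists>t\<ge>T. \<forall>m\<ge>N. driven a k (\<sigma> @ replicate m False) t"
proof -
  define X where "X m \<longleftrightarrow> m < length \<sigma> \<and> \<sigma> ! m" for m
  have "finite {n. X n}" by (rule finite_subset[of _ "{..<length \<sigma>}"]) (auto simp: X_def)
  with U have "X \<in> U k" by (rule universal_eventually_zero)
  moreover have "c_open (U k)" using U by (simp add: universal_ml_test_def ml_test_def)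
  ultimately obtain n where n: "cyl (map X [0..<n]) \<subseteq> U k" using c_open_prefix by metis
  obtain s where s: "approx (\<lambda>_. 1) s a [code_str k (map X [0..<n])] \<noteq> 0"
    using eventually_happens'[OF sequentially_bot approx_enumerates_complete[OF a n]] by blast
  have "driven a k (\<sigma> @ replicate m False) t" if "n \<le> m" "stage_length t = n" "stage_steps t = s" for m t
    unfolding driven_def that
    by (subst seen_in_prefix_iff[where X = X])
       (use that s in \<open>auto simp: known_def X_def nth_append\<close>)
  then show ?thesis using stage_exists by metis
qed

text \<open>The pairs \<open>(\<Phi>, \<Psi>)\<close> and \<open>(\<Phi>', \<Psi>')\<close> witness the reductions of the inner and of the outer function.
  A guess \<open>c\<close> codes \<open>(i, j)\<close>: the instance obtained from \<open>p\<close> avoids level \<open>i\<close>, and the instance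
  obtained from the resulting name avoids level \<open>j\<close>.\<close>

context
  fixes a \<Phi> \<Psi> \<Phi>' \<Psi>' :: rf
begin

definition inner_instance :: "(nat \<Rightarrow> nat) \<Rightarrow> nat \<Rightarrow> nat \<Rightarrow> nat" where
  "inner_instance p s n = approx (\<lambda>x. Suc (p x)) s \<Phi> [n]"

definition inner_solution :: "(nat \<Rightarrow> nat) \<Rightarrow> nat \<Rightarrow> nat \<Rightarrow> nat \<Rightarrow> nat" where
  "inner_solution p c s n = approx (\<lambda>x. Suc (bpair p (nat_name (fst (prod_decode c))) x)) s \<Psi> [n]"

definition outer_instance :: "(nat \<Rightarrow> nat) \<Rightarrow> nat \<Rightarrow> nat \<Rightarrow> nat \<Rightarrow> nat" where
  "outer_instance p c s n = approx (\<lambda>x. inner_solution p c s x) s \<Phi>' [n]"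

definition outer_solution :: "(nat \<Rightarrow> nat) \<Rightarrow> nat \<Rightarrow> nat \<Rightarrow> nat \<Rightarrow> nat" where
  "outer_solution p c s n =
     approx (\<lambda>x. bpair (\<lambda>m. inner_solution p c s m) (\<lambda>m. Suc (nat_name (snd (prod_decode c)) m)) x) s \<Psi>' [n]"

text \<open>For a wrong first component the second disjunct may hold spuriously, but then it
  discards a guess that is wrong anyway. Both disjuncts depend on \<open>t\<close> only through
  \<open>stage_length\<close> and \<open>stage_steps\<close>, so every refutation recurs.\<close>

definition refuted :: "(nat \<Rightarrow> nat) \<Rightarrow> nat \<Rightarrow> nat \<Rightarrow> bool" where
  "refuted p c t \<longleftrightarrow>
     seen_in a (\<lambda>m. inner_instance p (stage_steps t) m) (fst (prod_decode c)) (stage_length t) (stage_steps t) \<or>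
     seen_in a (\<lambda>m. outer_instance p c (stage_steps t) m) (snd (prod_decode c)) (stage_length t) (stage_steps t)"

definition run :: "(nat \<Rightarrow> nat) \<Rightarrow> nat \<Rightarrow> bool list \<times> nat \<times> nat \<times> nat" where
  "run p = guess_run (driven a) (refuted p) (outer_instance p)"

lemma computable_inner_instance:
  assumes "computable n A" "computable n B"
  shows "computable n (\<lambda>p xs. inner_instance p (A p xs) (B p xs))"
  unfolding inner_instance_def
  by (intro computable_approx computable_intros assms) simp

lemma computable_inner_solution:
  assumes "computable n A" "computable n B" "computable n C"
  shows "computable n (\<lambda>p xs. inner_solution p (A p xs) (B p xs) (C p xs))"
  unfolding inner_solution_def nat_name_def
  by (intro computable_approx computable_bpair computable_intros assms computable_drop[OF assms(1)];
      simp add: computable_drop[OF assms(1)])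

lemma computable_outer_instance:
  assumes "computable n A" "computable n B" "computable n C"
  shows "computable n (\<lambda>p xs. outer_instance p (A p xs) (B p xs) (C p xs))"
  unfolding outer_instance_def
  by (intro computable_approx computable_inner_solution computable_intros assms
      computable_drop[OF assms(1)] computable_drop[OF assms(2)]; simp)

lemma computable_outer_solution:
  assumes "computable n A" "computable n B" "computable n C"
  shows "computable n (\<lambda>p xs. outer_solution p (A p xs) (B p xs) (C p xs))"
  unfolding outer_solution_def nat_name_def
  by (intro computable_approx computable_bpair computable_inner_solution computable_intros assms
        computable_drop[OF assms(1)];
      simp add: computable_drop[OF assms(1)] computable_drop[OF assms(2)])

lemma decidable_refuted:
  assumes "computable n A" "computable n B"
  shows "decidable n (\<lambda>p xs. refuted p (A p xs) (B p xs))"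
  unfolding refuted_def
  by (intro decidable_disj decidable_seen_in computable_inner_instance computable_outer_instance
        computable_stage_length computable_stage_steps computable_intros assms
        computable_drop[OF assms(1)] computable_drop[OF assms(2)]; simp)

section \<open>Coding the run by numbers\<close>

definition known_code :: "nat \<Rightarrow> nat \<Rightarrow> nat \<Rightarrow> nat" where
  "known_code l r m = (if m < l then Suc (code_nth r (l - 1 - m)) else 0)"

lemma known_code_eq: "known_code (length \<sigma>) (list_encode (map of_bool (rev \<sigma>))) = known \<sigma>"
  by (rule ext) (simp add: known_code_def known_def code_nth_list_encode rev_nth)

lemma computable_known_code:
  assumes "computable n A" "computable n B" "computable n C"
  shows "computable n (\<lambda>p xs. known_code (A p xs) (B p xs) (C p xs))"
  unfolding known_code_def by (intro computable_intros computable_code_nth assms)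

text \<open>The length \<open>l\<close> is kept beside the string code \<open>r\<close>, so that the
  next output position is read off without recursion.\<close>

definition pack :: "nat \<Rightarrow> nat \<Rightarrow> nat \<Rightarrow> nat \<Rightarrow> nat \<Rightarrow> nat" where
  "pack l r c k b = prod_encode (prod_encode (l, r), prod_encode (c, prod_encode (k, b)))"

text \<open>The output is stored in reverse, so that appending a bit is a \<open>Cons\<close> on codes.\<close>

fun encode_state :: "bool list \<times> nat \<times> nat \<times> nat \<Rightarrow> nat" where
  "encode_state (\<sigma>, c, k, b) = pack (length \<sigma>) (list_encode (map of_bool (rev \<sigma>))) c k b"

definition step_code :: "(nat \<Rightarrow> nat) \<Rightarrow> nat \<Rightarrow> nat \<Rightarrow> nat" where
  "step_code p t m =
    (let l = fst (prod_decode (fst (prod_decode m))); r = snd (prod_decode (fst (prod_decode m)));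
         c = fst (prod_decode (snd (prod_decode m)));
         k = fst (prod_decode (snd (prod_decode (snd (prod_decode m)))));
         b = snd (prod_decode (snd (prod_decode (snd (prod_decode m)))))
     in if k < b then
          if seen_in a (\<lambda>i. known_code l r i) k (stage_length t) (stage_steps t) then pack l r c (Suc k) b
          else pack (Suc l) (Suc (prod_encode (0, r))) c k b
        else if refuted p c t then pack l r (Suc c) k (Suc t)
        else if outer_instance p c t l = 0 then m
        else pack (Suc l) (Suc (prod_encode (of_bool (outer_instance p c t l = 2), r))) c k b)"

lemma encode_state_step:
  "encode_state (guess_step (driven a) (refuted p) (outer_instance p) t st) = step_code p t (encode_state st)"
proof (cases st)
  case (fields \<sigma> c k b)
  then show ?thesis
    by (simp add: step_code_def pack_def known_code_eq driven_def)
qed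

lemma computable_run:
  assumes "computable n A"
  shows "computable n (\<lambda>p xs. encode_state (run p (A p xs)))"
proof -
  have *: "encode_state (run p t) = rec_nat (encode_state ([], 0, 0, 0)) (\<lambda>t m. step_code p t m) t" for p t
    by (induction t) (simp_all only: run_def guess_run.simps encode_state_step old.nat.simps)
  have "computable (Suc (Suc n)) (\<lambda>p ys. step_code p (ys ! 0) (ys ! 1))"
    unfolding step_code_def Let_def pack_def
    by (intro computable_if decidable_seen_in decidable_refuted computable_outer_instance computable_known_code
        computable_stage_length computable_stage_steps computable_intros; simp)
  then show ?thesis
    unfolding * by (intro computable_rec_nat computable_const assms)
qed

lemma encode_state_parts:
  "fst (prod_decode (snd (prod_decode (encode_state st)))) = fst (snd st)"
  "known_code (fst (prod_decode (fst (prod_decode (encode_state st)))))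
     (snd (prod_decode (fst (prod_decode (encode_state st))))) = known (fst st)"
  by (cases st; simp add: pack_def known_code_eq)+

lemma computable_run_guess:
  "computable n A \<Longrightarrow> computable n (\<lambda>p xs. fst (snd (run p (A p xs))))"
  unfolding encode_state_parts[symmetric] by (intro computable_intros computable_run)

lemma computable_run_known:
  "computable n A \<Longrightarrow> computable n B \<Longrightarrow> computable n (\<lambda>p xs. known (fst (run p (A p xs))) (B p xs))"
  unfolding encode_state_parts[symmetric] by (intro computable_known_code computable_intros computable_run)

lemma seen_at_some_stage_iff:
  assumes "enumerates a U" "ml_test U" "approximates G (\<lambda>n. of_bool (X n))"
  shows "(\<exists>t. seen_in a (\<lambda>m. G (stage_steps t) m) i (stage_length t) (stage_steps t)) \<longleftrightarrow> X \<in> U i"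
proof
  assume "\<exists>t. seen_in a (\<lambda>m. G (stage_steps t) m) i (stage_length t) (stage_steps t)"
  then show "X \<in> U i" using seen_in_sound[OF assms(1,3)] by blast
next
  assume "X \<in> U i"
  moreover have "c_open (U i)" using assms(2) by (simp add: ml_test_def)
  ultimately obtain n s where "seen_in a (G s) i n s"
    using seen_in_complete[OF assms(1) _ assms(3)] by blast
  moreover obtain t where "stage_length t = n" "stage_steps t = s" using stage_exists by blast
  ultimately show "\<exists>t. seen_in a (\<lambda>m. G (stage_steps t) m) i (stage_length t) (stage_steps t)" by auto
qed

lemma approximates_inner_instance: "tf \<Phi> p = Some x \<Longrightarrow> approximates (inner_instance p) x"
  unfolding inner_instance_def using approximates_approx[OF approximates_Suc] by simp

lemma approximates_inner_solution:
  "tf \<Psi> (bpair p (nat_name (fst (prod_decode c)))) = Some q \<Longrightarrow> approximates (inner_solution p c) q"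
  unfolding inner_solution_def using approximates_approx[OF approximates_Suc] by simp

lemma approximates_outer_instance:
  "approximates (inner_solution p c) q \<Longrightarrow> tf \<Phi>' q = Some y \<Longrightarrow> approximates (outer_instance p c) y"
  unfolding outer_instance_def using approximates_approx[of "inner_solution p c"] by simp

lemma approximates_outer_solution:
  assumes "approximates (inner_solution p c) q" "tf \<Psi>' (bpair q (nat_name (snd (prod_decode c)))) = Some r"
  shows "approximates (outer_solution p c) r"
  unfolding outer_solution_def
  using approximates_approx[OF approximates_bpair[OF assms(1) approximates_Suc] assms(2)] by simp

text \<open>For \<open>X \<in> U i\<close> the first disjunct of \<open>refuted\<close> already
  fires, so the behaviour of the second instance matters only for correct \<open>i\<close>, where
  \<open>q i\<close> and \<open>Y i\<close> are meaningful.\<close>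

lemma refuted_iff:
  assumes "enumerates a U" "ml_test U"
    and X: "tf \<Phi> p = Some (\<lambda>n. of_bool (X n))"
    and Y: "\<And>i. X \<notin> U i \<Longrightarrow> tf \<Psi> (bpair p (nat_name i)) = Some (q i) \<and> tf \<Phi>' (q i) = Some (\<lambda>n. of_bool (Y i n))"
  shows "(\<exists>t. refuted p (prod_encode (i, j)) t) \<longleftrightarrow> X \<in> U i \<or> Y i \<in> U j"
proof -
  let ?c = "prod_encode (i, j)"
  have "(\<exists>t. seen_in a (\<lambda>m. outer_instance p ?c (stage_steps t) m) j (stage_length t) (stage_steps t)) \<longleftrightarrow> Y i \<in> U j"
    if "X \<notin> U i"
  proof -
    have "approximates (inner_solution p ?c) (q i)"
      by (rule approximates_inner_solution) (simp add: Y[OF that])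
    then have "approximates (outer_instance p ?c) (\<lambda>n. of_bool (Y i n))"
      by (rule approximates_outer_instance) (simp add: Y[OF that])
    with assms(1,2) show ?thesis by (rule seen_at_some_stage_iff)
  qed
  moreover have "(\<exists>t. seen_in a (\<lambda>m. inner_instance p (stage_steps t) m) i (stage_length t) (stage_steps t)) \<longleftrightarrow> X \<in> U i"
    by (rule seen_at_some_stage_iff[OF assms(1,2) approximates_inner_instance[OF X]])
  ultimately show ?thesis unfolding refuted_def by auto
qed

lemma guessing_run:
  assumes a: "enumerates a U" and U: "universal_ml_test U"
    and X: "X \<in> MLR" "tf \<Phi> p = Some (\<lambda>n. of_bool (X n))"
    and Y: "\<And>i. X \<notin> U i \<Longrightarrow> Y i \<in> MLR \<and> tf \<Psi> (bpair p (nat_name i)) = Some (q i)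
      \<and> tf \<Phi>' (q i) = Some (\<lambda>n. of_bool (Y i n))"
  shows "guessing U (driven a) (refuted p) (outer_instance p)"
proof
  have ml: "ml_test U" using U by (simp add: universal_ml_test_def)
  have MLR: "\<exists>i. Z \<notin> U i" if "Z \<in> MLR" for Z using that ml unfolding MLR_def by blast
  have refuted: "(\<exists>t. refuted p (prod_encode (i, j)) t) \<longleftrightarrow> X \<in> U i \<or> Y i \<in> U j" for i j
    by (rule refuted_iff[OF a ml X(2)]) (use Y in blast)
  show "driven a k \<sigma> t \<Longrightarrow> cyl \<sigma> \<subseteq> U k" for k \<sigma> t using a by (rule driven_sound)
  show "\<exists>N. \<forall>T. \<exists>t\<ge>T. \<forall>m\<ge>N. driven a k (\<sigma> @ replicate m False) t" for k \<sigma>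
    using a U by (rule driven_reached)
  show "\<exists>t'\<ge>T. refuted p c t'" if "refuted p c t" for c t T
  proof -
    obtain t' where "t' \<ge> T" "stage_length t' = stage_length t" "stage_steps t' = stage_steps t"
      using stage_exists by blast
    with that show ?thesis unfolding refuted_def by auto
  qed
  \<comment> \<open>A random sequence escapes some level; applied to \<open>X\<close> and then to
    \<open>Y i\<close>, this yields a correct pair.\<close>
  obtain i where i: "X \<notin> U i" using MLR X(1) by blast
  moreover obtain j where "Y i \<notin> U j" using MLR Y[OF i] by blast
  ultimately show "\<exists>c. \<forall>t. \<not> refuted p c t" using refuted by blast
  fix c assume c: "\<And>t. \<not> refuted p c t"
  let ?i = "fst (prod_decode c)"
  have "X \<notin> U ?i" using refuted[of ?i "snd (prod_decode c)"] c by simp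
  note Y = Y[OF this]
  have "approximates (inner_solution p c) (q ?i)"
    by (rule approximates_inner_solution) (simp add: Y)
  then have app: "approximates (outer_instance p c) (\<lambda>n. of_bool (Y ?i n))"
    by (rule approximates_outer_instance) (simp add: Y)
  have "\<exists>t\<ge>T. outer_instance p c t n \<noteq> 0" for T n
  proof -
    have "\<forall>\<^sub>F s in sequentially. outer_instance p c s n = Suc (of_bool (Y ?i n))"
      using app by (simp add: approximates_def)
    from eventually_happens'[OF sequentially_bot eventually_conj[OF this eventually_ge_at_top[of T]]]
    show ?thesis by auto
  qed
  then show "\<exists>Y\<in>MLR. \<forall>n. (\<forall>t. outer_instance p c t n \<in> {0, Suc (of_bool (Y n))}) \<and>
      (\<forall>T. \<exists>t\<ge>T. outer_instance p c t n \<noteq> 0)"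
    using Y approximates_value[OF app] by (intro bexI[of _ "Y ?i"]) auto
qed

text \<open>The two codes are fixed before \<open>p\<close>, while \<open>Y\<close>,
  \<open>q\<close> and \<open>r\<close> may be chosen without effectivity: they merely name results
  of computations that the construction simulates.\<close>

lemma compose_reductions:
  assumes a: "enumerates a U" and U: "universal_ml_test U"
  obtains \<Phi>\<^sub>1 \<Psi>\<^sub>1 where
    "\<And>p X Y q r. X \<in> MLR \<Longrightarrow> tf \<Phi> p = Some (\<lambda>n. of_bool (X n)) \<Longrightarrow>
      (\<And>i. X \<notin> U i \<Longrightarrow> Y i \<in> MLR \<and> tf \<Psi> (bpair p (nat_name i)) = Some (q i)
        \<and> tf \<Phi>' (q i) = Some (\<lambda>n. of_bool (Y i n))) \<Longrightarrow>
      (\<And>i j. X \<notin> U i \<Longrightarrow> Y i \<notin> U j \<Longrightarrow> tf \<Psi>' (bpair (q i) (nat_name j)) = Some (r i j)) \<Longrightarrow>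
      \<exists>Z\<in>MLR. tf \<Phi>\<^sub>1 p = Some (\<lambda>n. of_bool (Z n)) \<and>
        (\<forall>z. Z \<notin> U z \<longrightarrow>
          (\<exists>i j. X \<notin> U i \<and> Y i \<notin> U j \<and> tf \<Psi>\<^sub>1 (bpair p (nat_name z)) = Some (r i j)))"
proof -
  have ml: "ml_test U" using U by (simp add: universal_ml_test_def)
  have "computable 2 (\<lambda>p ys. known (fst (run p (ys ! 0))) (ys ! 1))"
    by (intro computable_run_known computable_nth) simp_all
  then obtain \<Phi>\<^sub>1 where \<Phi>\<^sub>1: "\<And>p g. (\<And>t n. known (fst (run p t)) n \<in> {0, Suc (g n)}) \<Longrightarrow>
      (\<And>n. \<exists>t. known (fst (run p t)) n \<noteq> 0) \<Longrightarrow> tf \<Phi>\<^sub>1 p = Some g"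
    by (rule tf_from_approx) blast
  \<comment> \<open>Here \<open>u\<close> codes a candidate level and a step bound. The odd half of
    \<open>P\<close> marks the true level \<open>z\<close> by a nonzero entry; other candidates give
    "unknown". For \<open>z\<close> itself, the guess after \<open>z\<close> stages is used to
    simulate the outer solution.\<close>
  define B where "B P u n = (if P (2 * fst (prod_decode u) + 1) = 0 then 0
    else outer_solution (\<lambda>m. P (2 * m)) (fst (snd (run (\<lambda>m. P (2 * m)) (fst (prod_decode u)))))
      (snd (prod_decode u)) n)" for P u n
  have even: "computable 1 (\<lambda>P xs. P (2 * (xs ! 0)))"
    by (intro computable_intros) simp
  have sol: "computable 3 (\<lambda>P xs. outer_solution (\<lambda>m. P (2 * m)) (xs ! 0) (xs ! 1) (xs ! 2))"
    by (rule computable_change_oracle[OF _ even], intro computable_outer_solution computable_nth) simp_all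
  have gue: "computable 1 (\<lambda>P xs. fst (snd (run (\<lambda>m. P (2 * m)) (xs ! 0))))"
    by (rule computable_change_oracle[OF _ even], intro computable_run_guess computable_nth) simp_all
  have "computable 2 (\<lambda>P ys. B P (ys ! 0) (ys ! 1))"
    unfolding B_def
    by (intro computable_if decidable_eq_zero computable_compose3[OF sol] computable_compose1[OF gue]
        computable_intros) simp_all
  then obtain \<Psi>\<^sub>1 where \<Psi>\<^sub>1: "\<And>P g. (\<And>u n. B P u n \<in> {0, Suc (g n)}) \<Longrightarrow>
      (\<And>n. \<exists>u. B P u n \<noteq> 0) \<Longrightarrow> tf \<Psi>\<^sub>1 P = Some g"
    by (rule tf_from_approx) blast
  show thesis
  proof (rule that)
    fix p X Y q r
    assume X: "X \<in> MLR" "tf \<Phi> p = Some (\<lambda>n. of_bool (X n))"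
      and Y: "\<And>i. X \<notin> U i \<Longrightarrow> Y i \<in> MLR \<and> tf \<Psi> (bpair p (nat_name i)) = Some (q i)
        \<and> tf \<Phi>' (q i) = Some (\<lambda>n. of_bool (Y i n))"
      and r: "\<And>i j. X \<notin> U i \<Longrightarrow> Y i \<notin> U j \<Longrightarrow> tf \<Psi>' (bpair (q i) (nat_name j)) = Some (r i j)"
    interpret guessing U "driven a" "refuted p" "outer_instance p"
      using a U X Y by (rule guessing_run)
    have out: "fst (run p t) = out t" and guess: "fst (snd (run p t)) = guess t" for t
      by (simp_all add: run_def out_def guess_def)
    obtain Z where Z: "Z \<in> MLR" "\<And>t n. n < length (out t) \<Longrightarrow> out t ! n = Z n"
      "\<And>n. \<exists>t. n < length (out t)" "\<And>z t. Z \<notin> U z \<Longrightarrow> \<not> refuted p (guess z) t"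
      using limit_output by blast
    have "tf \<Phi>\<^sub>1 p = Some (\<lambda>n. of_bool (Z n))"
      by (rule \<Phi>\<^sub>1) (use Z(2,3) in \<open>auto simp: out known_def\<close>)
    moreover have "\<exists>i j. X \<notin> U i \<and> Y i \<notin> U j \<and> tf \<Psi>\<^sub>1 (bpair p (nat_name z)) = Some (r i j)"
      if "Z \<notin> U z" for z
    proof -
      define c where "c = guess z"
      obtain i j where c: "c = prod_encode (i, j)" by (metis prod_decode_inverse surj_pair)
      have "\<not> (\<exists>t. refuted p (prod_encode (i, j)) t)" using Z(4)[OF that] c c_def by simp
      moreover have "(\<exists>t. refuted p (prod_encode (i, j)) t) \<longleftrightarrow> X \<in> U i \<or> Y i \<in> U j"
        by (rule refuted_iff[OF a ml X(2)]) (use Y in blast)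
      ultimately have ij: "X \<notin> U i" "Y i \<notin> U j" by blast+
      have "approximates (inner_solution p c) (q i)"
        by (rule approximates_inner_solution) (use Y[OF ij(1)] c in simp)
      then have app: "approximates (outer_solution p c) (r i j)"
        by (rule approximates_outer_solution) (use r[OF ij] c in simp)
      let ?P = "bpair p (nat_name z)"
      have "(\<lambda>m. ?P (2 * m)) = p" "?P (2 * m + 1) = nat_name z m" for m
        by (simp_all add: bpair_def)
      then have B: "B ?P u n = (if fst (prod_decode u) = z then outer_solution p c (snd (prod_decode u)) n else 0)" for u n
        by (simp add: B_def guess c_def nat_name_def)
      have "tf \<Psi>\<^sub>1 ?P = Some (r i j)"
      proof (rule \<Psi>\<^sub>1)
        show "B ?P u n \<in> {0, Suc (r i j n)}" for u n
          using approximates_value[OF app] by (simp add: B)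
        show "\<exists>u. B ?P u n \<noteq> 0" for n
        proof -
          have "\<forall>\<^sub>F s in sequentially. outer_solution p c s n = Suc (r i j n)"
            using app by (simp add: approximates_def)
          then obtain s where "outer_solution p c s n = Suc (r i j n)"
            using eventually_happens'[OF sequentially_bot] by blast
          then show ?thesis by (intro exI[of _ "prod_encode (z, s)"]) (simp add: B)
        qed
      qed
      with ij show ?thesis by blast
    qed
    ultimately show "\<exists>Z\<in>MLR. tf \<Phi>\<^sub>1 p = Some (\<lambda>n. of_bool (Z n)) \<and>
        (\<forall>z. Z \<notin> U z \<longrightarrow>
          (\<exists>i j. X \<notin> U i \<and> Y i \<notin> U j \<and> tf \<Psi>\<^sub>1 (bpair p (nat_name z)) = Some (r i j)))"
      using Z(1) by blast
  qed
qed

end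

theorem theorem5p9:
  fixes U :: "nat \<Rightarrow> (nat \<Rightarrow> bool) set"
    and \<delta>Q :: "(nat \<Rightarrow> nat) \<Rightarrow> 'q option"
    and \<delta>R :: "(nat \<Rightarrow> nat) \<Rightarrow> 'r option"
    and \<delta>S :: "(nat \<Rightarrow> nat) \<Rightarrow> 's option"
    and f0 :: "'r \<Rightarrow> 's set" and g0 :: "'q \<Rightarrow> 'r set"
  assumes "universal_ml_test U"
    and "mvf \<delta>R \<delta>S f0" and "mvf \<delta>Q \<delta>R g0"
    and "W_le \<delta>R \<delta>S f0 delta_MLR delta_nat (LAY U)"
    and "W_le \<delta>Q \<delta>R g0 delta_MLR delta_nat (LAY U)"
    and "\<forall>x. g0 x \<noteq> {} \<longrightarrow> (\<forall>y\<in>g0 x. f0 y \<noteq> {})"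
  shows "W_le \<delta>Q \<delta>S (mv_comp f0 g0) delta_MLR delta_nat (LAY U)"
proof -
  have ml: "ml_test U" using assms(1) by (simp add: universal_ml_test_def)
  obtain a where a: "enumerates a U" using ml by (rule ml_test_enumerates)
  obtain \<Phi> \<Psi> where g: "\<And>p x. \<delta>Q p = Some x \<Longrightarrow> g0 x \<noteq> {} \<Longrightarrow>
       (\<exists>X\<in>MLR. tf \<Phi> p = Some (\<lambda>n. of_bool (X n)) \<and>
         (\<forall>i. X \<notin> U i \<longrightarrow> (\<exists>q y. tf \<Psi> (bpair p (nat_name i)) = Some q \<and> \<delta>R q = Some y \<and> y \<in> g0 x)))"
    using assms(5) unfolding W_le_LAY_iff[OF ml] by blast
  obtain \<Phi>' \<Psi>' where f: "\<And>q y. \<delta>R q = Some y \<Longrightarrow> f0 y \<noteq> {} \<Longrightarrow>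
       (\<exists>Y\<in>MLR. tf \<Phi>' q = Some (\<lambda>n. of_bool (Y n)) \<and>
         (\<forall>j. Y \<notin> U j \<longrightarrow> (\<exists>r z. tf \<Psi>' (bpair q (nat_name j)) = Some r \<and> \<delta>S r = Some z \<and> z \<in> f0 y)))"
    using assms(4) unfolding W_le_LAY_iff[OF ml] by blast
  obtain \<Phi>\<^sub>1 \<Psi>\<^sub>1 where comp:
    "\<And>p X Y q r. X \<in> MLR \<Longrightarrow> tf \<Phi> p = Some (\<lambda>n. of_bool (X n)) \<Longrightarrow>
      (\<And>i. X \<notin> U i \<Longrightarrow> Y i \<in> MLR \<and> tf \<Psi> (bpair p (nat_name i)) = Some (q i)
        \<and> tf \<Phi>' (q i) = Some (\<lambda>n. of_bool (Y i n))) \<Longrightarrow>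
      (\<And>i j. X \<notin> U i \<Longrightarrow> Y i \<notin> U j \<Longrightarrow> tf \<Psi>' (bpair (q i) (nat_name j)) = Some (r i j)) \<Longrightarrow>
      \<exists>Z\<in>MLR. tf \<Phi>\<^sub>1 p = Some (\<lambda>n. of_bool (Z n)) \<and>
        (\<forall>z. Z \<notin> U z \<longrightarrow>
          (\<exists>i j. X \<notin> U i \<and> Y i \<notin> U j \<and> tf \<Psi>\<^sub>1 (bpair p (nat_name z)) = Some (r i j)))"
    using compose_reductions[OF a assms(1), of \<Phi> \<Psi> \<Phi>' \<Psi>'] by blast
  show ?thesis
    unfolding W_le_LAY_iff[OF ml]
  proof (intro exI allI impI)
    fix p x assume p: "\<delta>Q p = Some x" and "mv_comp f0 g0 x \<noteq> {}"
    then have gx: "g0 x \<noteq> {}" by (auto simp: mv_comp_def)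
    obtain X where X: "X \<in> MLR" "tf \<Phi> p = Some (\<lambda>n. of_bool (X n))"
      "\<forall>i. X \<notin> U i \<longrightarrow> (\<exists>q y. tf \<Psi> (bpair p (nat_name i)) = Some q \<and> \<delta>R q = Some y \<and> y \<in> g0 x)"
      using g[OF p gx] by blast
    from X(3) obtain q y where qy: "\<And>i. X \<notin> U i \<Longrightarrow>
        tf \<Psi> (bpair p (nat_name i)) = Some (q i) \<and> \<delta>R (q i) = Some (y i) \<and> y i \<in> g0 x"
      by metis
    \<comment> \<open>Composability makes each \<open>y i\<close> an instance of \<open>f0\<close>,
      whichever correct level \<open>i\<close> was used.\<close>
    have "\<forall>i. X \<notin> U i \<longrightarrow> (\<exists>Y\<in>MLR. tf \<Phi>' (q i) = Some (\<lambda>n. of_bool (Y n)) \<and>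
         (\<forall>j. Y \<notin> U j \<longrightarrow> (\<exists>r z. tf \<Psi>' (bpair (q i) (nat_name j)) = Some r \<and> \<delta>S r = Some z \<and> z \<in> f0 (y i))))"
      using f qy assms(6) gx by blast
    then obtain Y where Y: "\<And>i. X \<notin> U i \<Longrightarrow> Y i \<in> MLR \<and> tf \<Phi>' (q i) = Some (\<lambda>n. of_bool (Y i n))"
      and Y': "\<forall>i j. X \<notin> U i \<and> Y i \<notin> U j \<longrightarrow>
         (\<exists>r z. tf \<Psi>' (bpair (q i) (nat_name j)) = Some r \<and> \<delta>S r = Some z \<and> z \<in> f0 (y i))"
      by metis
    from Y' obtain r z where rz: "\<And>i j. X \<notin> U i \<Longrightarrow> Y i \<notin> U j \<Longrightarrow>
         tf \<Psi>' (bpair (q i) (nat_name j)) = Some (r i j) \<and> \<delta>S (r i j) = Some (z i j) \<and> z i j \<in> f0 (y i)"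
      by metis
    have "\<exists>Z\<in>MLR. tf \<Phi>\<^sub>1 p = Some (\<lambda>n. of_bool (Z n)) \<and>
        (\<forall>z. Z \<notin> U z \<longrightarrow>
          (\<exists>i j. X \<notin> U i \<and> Y i \<notin> U j \<and> tf \<Psi>\<^sub>1 (bpair p (nat_name z)) = Some (r i j)))"
      by (rule comp[OF X(1,2)]) (use Y qy rz in blast)+
    then obtain Z where Z: "Z \<in> MLR" "tf \<Phi>\<^sub>1 p = Some (\<lambda>n. of_bool (Z n))"
      "\<And>k. Z \<notin> U k \<Longrightarrow> \<exists>i j. X \<notin> U i \<and> Y i \<notin> U j \<and> tf \<Psi>\<^sub>1 (bpair p (nat_name k)) = Some (r i j)"
      by blast
    have "\<exists>r' w. tf \<Psi>\<^sub>1 (bpair p (nat_name k)) = Some r' \<and> \<delta>S r' = Some w \<and> w \<in> mv_comp f0 g0 x"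
      if "Z \<notin> U k" for k
    proof -
      obtain i j where "X \<notin> U i" "Y i \<notin> U j" "tf \<Psi>\<^sub>1 (bpair p (nat_name k)) = Some (r i j)"
        using Z(3)[OF \<open>Z \<notin> U k\<close>] by blast
      with rz[of i j] qy[of i] show ?thesis by (auto simp: mv_comp_def)
    qed
    with Z(1,2) show "\<exists>Z\<in>MLR. tf \<Phi>\<^sub>1 p = Some (\<lambda>n. of_bool (Z n)) \<and>
      (\<forall>k. Z \<notin> U k \<longrightarrow> (\<exists>r' w. tf \<Psi>\<^sub>1 (bpair p (nat_name k)) = Some r' \<and> \<delta>S r' = Some w \<and> w \<in> mv_comp f0 g0 x))"
      by blast
  qed
qed

end
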